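(* Let $ABC$ be a triangle. Fix a parallelogram $H_1U_1P_1V_1$ together with the associated points $Z_1,O_1,G_1,Q_1,Q_1',P_1'$ and the corresponding hyperbola $\mathcal{C}=P_1Q_1H_1Q_1'P_1'$, and let $\mathscr{A}\subset\mathcal{C}$ be the associated union of six open arcs of $\mathcal{C}$ (all defined in the context). Let $$\mathcal{E}_S:\ x(y+z)^2+y(x+z)^2+z(x+y)^2=0$$ in homogeneous barycentric coordinates with respect to $ABC$, and let $T_{12}\subset\mathcal{E}_S$ be its torsion subgroup of 12 points corresponding to the vertices of $ABC$, the infinite points on its sides, and the points of $\mathcal{E}_S$ lying on the medians of $ABC$. Then $\mathcal{E}_S\setminus T_{12}$ is the locus of images $\mathsf{A}(P_1)$, where $A_1$ is a point of $\mathscr{A}$, $B_1$ and $C_1$ are the unique points on $\mathcal{C}$ for which triangle $A_1B_1C_1$ has centroid $G_1$, and $\mathsf{A}$ is one of the two affine maps $\mathsf{A}_1,\mathsf{A}_2$ for which $\mathsf{A}_1(A_1B_1C_1)=ABC$ or $\mathsf{A}_2(A_1C_1B_1)=ABC$ (vertices corresponding in the order listed).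
   Context: Everything is over the real numbers, in the extended Euclidean plane with line at infinity $l_\infty$; $\mathcal{E}_S$ denotes the set of real points of the cubic. Configuration. $H_1U_1P_1V_1$ is a (non-degenerate) parallelogram with center $Z_1$ (so $Z_1$ is the midpoint of both $U_1V_1$ and $H_1P_1$); $O_1$ is the midpoint of $U_1P_1$; $G_1=U_1V_1\cap H_1O_1$; $Q_1$ is the midpoint of $P_1V_1$ and $Q_1'$ is the midpoint of $H_1U_1$; $P_1'$ is the image of $P_1$ under the affine reflection that fixes the line $U_1V_1$ pointwise and moves points parallel to $U_1P_1$ (so $P_1'$ is the reflection of $P_1$ in $U_1$). $\mathcal{C}$ is the conic through $P_1,Q_1,H_1,Q_1',P_1'$; it is a hyperbola with center $Z_1$, and the line $U_1V_1$ does not meet it. The line through $G_1$ parallel to $P_1P_1'$ meets $\mathcal{C}$ in two points $E$ and $F$, where $E$ is on the branch of $\mathcal{C}$ containing $P_1',Q_1'$ and $F$ is on the branch containing $P_1,Q_1$. Let $\overline{\mathscr{E}}$ be the closed arc of $\mathcal{C}$ from $E$ to $P_1'$ and $\overline{\mathscr{F}}$ the closed arc from $F$ to $P_1$ (each within one branch), and let $A_\infty,B_\infty$ be the two points of $\mathcal{C}$ on $l_\infty$. Put $$\mathscr{A}=\mathcal{C}\setminus\big(\overline{\mathscr{E}}\cup\overline{\mathscr{F}}\cup\{Q_1,Q_1',A_\infty,B_\infty\}\big).$$ The set $T_{12}$ consists of $A,B,C$; the infinite points $(0,1,-1),(1,0,-1),(1,-1,0)$ on the sides; and the six points $(1,t,t),(t,1,t),(t,t,1)$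 with $t=-2\pm\sqrt3$, which are the points of $\mathcal{E}_S$ other than vertices on the medians of $ABC$. *)

theory Defs
  imports "HOL-Analysis.Analysis"
begin

(* A point of the extended Euclidean plane is a line through the origin of real^2 x real:
   the ordinary point X is the line spanned by (X, 1), and the point at infinity in the
   direction d is the line spanned by (d, 0). *)

type_synonym ext_point = "((real^2) \<times> real) set"

definition pt :: "real^2 \<Rightarrow> ext_point" where
  "pt X = span {(X, 1)}"

definition line_at_infinity :: "ext_point set" where
  "line_at_infinity = {span {(d, 0)} | d. d \<noteq> 0}"

definition affine_part :: "ext_point set \<Rightarrow> (real^2) set" where
  "affine_part S = {X. pt X \<in> S}"

(* Real zero set of a nonzero quadratic form v |-> \<beta> v v in homogeneous coordinates.
   Degenerate forms are allowed; a conic through five given points, no four of them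
   collinear, is unique. *)
definition is_conic :: "ext_point set \<Rightarrow> bool" where
  "is_conic S \<longleftrightarrow> (\<exists>\<beta> :: (real^2) \<times> real \<Rightarrow> (real^2) \<times> real \<Rightarrow> real.
     bilinear \<beta> \<and> (\<exists>v. \<beta> v v \<noteq> 0) \<and> S = {span {v} | v. v \<noteq> 0 \<and> \<beta> v v = 0})"

definition is_triangle :: "real^2 \<Rightarrow> real^2 \<Rightarrow> real^2 \<Rightarrow> bool" where
  "is_triangle A B C \<longleftrightarrow> \<not> collinear {A, B, C}"

definition centroid :: "real^2 \<Rightarrow> real^2 \<Rightarrow> real^2 \<Rightarrow> real^2" where
  "centroid A B C = (1/3) *\<^sub>R (A + B + C)"

definition parallelogram :: "real^2 \<Rightarrow> real^2 \<Rightarrow> real^2 \<Rightarrow> real^2 \<Rightarrow> bool" where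
  "parallelogram H U P V \<longleftrightarrow> is_triangle H U P \<and> U - H = P - V"

definition affine_map :: "(real^2 \<Rightarrow> real^2) \<Rightarrow> bool" where
  "affine_map f \<longleftrightarrow> (\<exists>L c. linear L \<and> bij L \<and> f = (\<lambda>X. L X + c))"

definition affine_reflection :: "(real^2) set \<Rightarrow> real^2 \<Rightarrow> (real^2 \<Rightarrow> real^2) \<Rightarrow> bool" where
  "affine_reflection l d \<rho> \<longleftrightarrow> affine_map \<rho> \<and> (\<forall>X\<in>l. \<rho> X = X) \<and>
     (\<forall>X. \<rho> X - X \<in> span {d} \<and> midpoint X (\<rho> X) \<in> l)"

(* K is an arc joining X and Y inside S.  When S is the affine part of a hyperbola, K lies in
   one branch because it is connected, and is determined by X and Y. *)
definition closed_arc :: "(real^2) set \<Rightarrow> real^2 \<Rightarrow> real^2 \<Rightarrow> (real^2) set \<Rightarrow> bool" where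
  "closed_arc S X Y K \<longleftrightarrow>
     (\<exists>g. arc g \<and> pathstart g = X \<and> pathfinish g = Y \<and> path_image g = K \<and> K \<subseteq> S)"

(* The point with homogeneous barycentric coordinates (x, y, z), not all zero, with respect to
   ABC.  It is at infinity exactly when x + y + z = 0. *)
definition bary :: "real^2 \<Rightarrow> real^2 \<Rightarrow> real^2 \<Rightarrow> real \<Rightarrow> real \<Rightarrow> real \<Rightarrow> ext_point" where
  "bary A B C x y z = span {(x *\<^sub>R A + y *\<^sub>R B + z *\<^sub>R C, x + y + z)}"

definition cubic_ES :: "real^2 \<Rightarrow> real^2 \<Rightarrow> real^2 \<Rightarrow> ext_point set" where
  "cubic_ES A B C = {bary A B C x y z | x y z. (x, y, z) \<noteq> (0, 0, 0) \<and>
     x * (y + z)^2 + y * (x + z)^2 + z * (x + y)^2 = 0}"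

(* The vertices, the infinite points on the sides, and the points other than vertices in which
   the medians y = z, x = z, x = y meet the cubic (t^2 + 4 t + 1 = 0).  This is the subgroup of
   twelve torsion points; over the reals the cubic has further points of finite order. *)
definition T12 :: "real^2 \<Rightarrow> real^2 \<Rightarrow> real^2 \<Rightarrow> ext_point set" where
  "T12 A B C =
     {bary A B C 1 0 0, bary A B C 0 1 0, bary A B C 0 0 1} \<union>
     {bary A B C 0 1 (-1), bary A B C 1 0 (-1), bary A B C 1 (-1) 0} \<union>
     (\<Union>t\<in>{-2 + sqrt 3, -2 - sqrt 3}.
        {bary A B C 1 t t, bary A B C t 1 t, bary A B C t t 1})"

end

theory Submission
  imports Defs
begin

text \<open>
  The configuration has one affine type: in the affine coordinates \<open>(h, k)\<close> with origin \<open>Z1\<close>,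
  \<open>U1 = (1, 0)\<close> and \<open>P1 = (1, 2)\<close>, the five points through which the conic passes are
  \<open>(1, 2)\<close>, \<open>(0, 1)\<close>, \<open>(-1, -2)\<close>, \<open>(0, -1)\<close>, \<open>(1, -2)\<close>, so the conic is the hyperbola
  \<open>Q = k^2 - 3 h^2 = 1\<close> (\<open>conic_affine_part\<close>), and \<open>G1 = (1/3, 0)\<close>.  The line \<open>EF\<close> is \<open>h = 1/3\<close>,
  the line joining \<open>P1\<close> and its mirror image is \<open>h = 1\<close>, and \<open>Q1\<close>, \<open>Q1'\<close> are the points with
  \<open>h = 0\<close>.  On each branch \<open>h\<close> is a global coordinate, so the two closed arcs together are the part
  \<open>1/3 \<le> h \<le> 1\<close> of the hyperbola (\<open>closed_arc_hyperbola\<close>).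

  A triangle with centroid \<open>G1\<close> and vertex \<open>A1 = (h, k)\<close> has its opposite side bisected by a known
  point, and a chord of a conic with prescribed midpoint other than the centre is unique.  If \<open>p\<close> is
  the difference of the \<open>h\<close>-coordinates of \<open>B1\<close> and \<open>C1\<close>, then
  \<open>p^2 (1 - 3 h) = (1 - h) (1 + 3 h^2)\<close>, and the area of the triangle vanishes exactly when
  \<open>h p = 0\<close>.  Hence the triangle exists precisely when \<open>h \<noteq> 0\<close> and \<open>h\<close> lies outside \<open>[1/3, 1]\<close>, that
  is, when \<open>A1\<close> lies in \<open>\<A>\<close>; this is the first half of the theorem, and in the second half it shows
  that the vertex \<open>A1\<close> of a triangle constructed from a point of the cubic lies in \<open>\<A>\<close>.

  An affine map preserves barycentric coordinates, so the locus consists of the points whose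
  coordinates \<open>(x, y, z)\<close> are those of \<open>P1\<close> with respect to some such triangle \<open>A1 B1 C1\<close>.  Measure
  its sides by \<open>Q\<close>: let \<open>\<alpha> = Q (B1 - C1) / 2\<close>, and \<open>\<beta>\<close>, \<open>\<gamma>\<close> likewise.  The position of the centroid
  gives \<open>\<alpha> + \<beta> + \<gamma> = 6\<close>, and \<open>h = 1\<close> and \<open>Q = 1\<close> at \<open>P1\<close> give \<open>x \<alpha> + y \<beta> + z \<gamma> = 0\<close> and
  \<open>y z \<alpha> + x z \<beta> + x y \<gamma> = 0\<close>; the last equation is that of the circumscribed "circle" of \<open>Q\<close>, which is
  the hyperbola.  These three linear equations determine \<open>\<alpha>\<close>, \<open>\<beta>\<close>, \<open>\<gamma>\<close> from \<open>x\<close>, \<open>y\<close>, \<open>z\<close> as multiples of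
  \<open>x (y^2 - z^2)\<close>, \<open>y (z^2 - x^2)\<close>, \<open>z (x^2 - y^2)\<close>, whose sum is \<open>(x - y) (y - z) (z - x)\<close>; on
  a median all three multiples would have to vanish, which leaves a few points that are excluded
  directly (\<open>weight_system_distinct\<close>).  There is one condition left: three vectors in the plane
  have vanishing Gram determinant.  After the substitution this determinant is the cubic times nonzero factors
  (\<open>gram_cubic_factorization\<close>).  That proves that the locus lies on the cubic
  (\<open>weight_system_cubic\<close>); conversely, from a point of the cubic the numbers \<open>\<alpha>\<close>, \<open>\<beta>\<close>, \<open>\<gamma>\<close> and then the
  vertices are recovered by rational formulas (\<open>weight_system_pell_triple\<close>).  Finally, the twelve
  torsion points are exactly the points of the cubic with \<open>x y z = 0\<close> or with two equal coordinates
  (\<open>cubic_ES_minus_T12\<close>), which is what the construction misses.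
\<close>

section \<open>Triangles inscribed in the hyperbola\<close>

text \<open>
  The vertices of a triangle, possibly degenerate, that is inscribed in the hyperbola and has
  centroid \<open>(1/3, 0)\<close>.
\<close>

definition pell_triple :: "real \<Rightarrow> real \<Rightarrow> real \<Rightarrow> real \<Rightarrow> real \<Rightarrow> real \<Rightarrow> bool" where
  "pell_triple h k h1 k1 h2 k2 \<longleftrightarrow>
     k^2 - 3 * h^2 = 1 \<and> k1^2 - 3 * h1^2 = 1 \<and> k2^2 - 3 * h2^2 = 1 \<and>
     h + h1 + h2 = 1 \<and> k + k1 + k2 = 0"

text \<open>
  Twice the signed area, in units of the coordinate parallelogram.
\<close>

definition area :: "real \<Rightarrow> real \<Rightarrow> real \<Rightarrow> real \<Rightarrow> real \<Rightarrow> real \<Rightarrow> real" where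
  "area h k h1 k1 h2 k2 = (h1 - h) * (k2 - k) - (k1 - k) * (h2 - h)"

lemma pell_triple_rotate:
  "pell_triple h k h1 k1 h2 k2 \<Longrightarrow> pell_triple h1 k1 h2 k2 h k"
  by (auto simp: pell_triple_def)

lemma area_rotate: "area h1 k1 h2 k2 h k = area h k h1 k1 h2 k2"
  by (simp add: area_def algebra_simps)

text \<open>
  The midpoint of the chord from \<open>(h1, k1)\<close> to \<open>(h2, k2)\<close> is determined by \<open>(h, k)\<close>.  The chord is
  conjugate to the diameter through its midpoint, which is the first equation; eliminating its
  \<open>k\<close>-component from the equation of the hyperbola gives its extent in the \<open>h\<close>-direction,
  which is the second.
\<close>

lemma pell_triple_chord:
  assumes "pell_triple h k h1 k1 h2 k2"
  shows "k * (k1 - k2) = - 3 * (1 - h) * (h1 - h2)"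
    and "(1 - h) * (1 + 3 * h^2) = (h1 - h2)^2 * (1 - 3 * h)"
proof -
  have A: "k^2 = 1 + 3 * h^2" and B: "k1^2 - 3 * h1^2 = 1" and C: "k2^2 - 3 * h2^2 = 1"
    and h: "h1 + h2 = 1 - h" and k: "k1 + k2 = - k"
    using assms by (auto simp: pell_triple_def)
  have "(k1 + k2) * (k1 - k2) = 3 * ((h1 + h2) * (h1 - h2))"
    using B C by (simp add: algebra_simps power2_eq_square)
  then show 1: "k * (k1 - k2) = - 3 * (1 - h) * (h1 - h2)"
    unfolding h k by (simp add: algebra_simps)
  have "(k1 + k2)^2 + (k1 - k2)^2 - 3 * (h1 + h2)^2 - 3 * (h1 - h2)^2 = 4"
    using B C by (simp add: algebra_simps power2_eq_square)
  then have 2: "(k1 - k2)^2 = 3 * (h1 - h2)^2 + 6 * (1 - h)"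
    unfolding h k power2_minus A by (simp add: algebra_simps power2_eq_square)
  have "k^2 * (k1 - k2)^2 = 9 * (1 - h)^2 * (h1 - h2)^2"
    unfolding power_mult_distrib[symmetric] 1 by (simp add: algebra_simps power2_eq_square)
  then have "(1 + 3 * h^2) * (3 * (h1 - h2)^2 + 6 * (1 - h)) = 9 * (1 - h)^2 * (h1 - h2)^2"
    unfolding 2 A .
  then show "(1 - h) * (1 + 3 * h^2) = (h1 - h2)^2 * (1 - 3 * h)"
    by (simp add: algebra_simps power2_eq_square)
qed

lemma pell_triple_area:
  assumes "pell_triple h k h1 k1 h2 k2"
  shows "k * area h k h1 k1 h2 k2 = - 6 * h * (h1 - h2)"
proof -
  have h: "h1 + h2 = 1 - h" and k: "k1 + k2 = - k" and A: "k^2 = 1 + 3 * h^2"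
    using assms by (auto simp: pell_triple_def)
  have "2 * area h k h1 k1 h2 k2 =
      (h1 - h2) * (k1 + k2 - 2 * k) - (k1 - k2) * (h1 + h2 - 2 * h)"
    by (simp add: area_def algebra_simps)
  also have "\<dots> = - 3 * k * (h1 - h2) - (k1 - k2) * (1 - 3 * h)"
    unfolding h k by (simp add: algebra_simps)
  finally have "k * (2 * area h k h1 k1 h2 k2) =
      k * (- 3 * k * (h1 - h2) - (k1 - k2) * (1 - 3 * h))"
    by simp
  then have "2 * (k * area h k h1 k1 h2 k2) =
      - 3 * k^2 * (h1 - h2) - k * (k1 - k2) * (1 - 3 * h)"
    by (simp add: algebra_simps power2_eq_square)
  then show ?thesis
    unfolding A pell_triple_chord(1)[OF assms] by (simp add: algebra_simps power2_eq_square)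
qed

lemma pell_nonzero: "k^2 - 3 * h^2 = 1 \<Longrightarrow> k \<noteq> (0::real)"
  by (smt (verit) zero_le_power2 power_zero_numeral)

lemma pell_triple_area_nonzero_iff:
  assumes "pell_triple h k h1 k1 h2 k2"
  shows "area h k h1 k1 h2 k2 \<noteq> 0 \<longleftrightarrow> h \<noteq> 0 \<and> h1 \<noteq> h2"
  using pell_triple_area[OF assms] pell_nonzero[of k h] assms
  by (auto simp: pell_triple_def)

text \<open>
  For \<open>1/3 \<le> h \<le> 1\<close> the two sides of the chord equation have opposite signs, so both vanish and the
  chord degenerates; for \<open>h = 0\<close> one end of the chord is the given vertex.
\<close>

lemma pell_triple_range:
  assumes t: "pell_triple h k h1 k1 h2 k2" and "area h k h1 k1 h2 k2 \<noteq> 0"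
  shows "h \<noteq> 0" "h < 1/3 \<or> 1 < h"
proof -
  have ne: "h \<noteq> 0" "h1 \<noteq> h2"
    using assms pell_triple_area_nonzero_iff by blast+
  show "h \<noteq> 0" by fact
  have p: "(h1 - h2)^2 > 0" "1 + 3 * h^2 > 0"
    using ne by (simp_all add: add_pos_nonneg)
  show "h < 1/3 \<or> 1 < h"
  proof (rule ccontr)
    assume "\<not> ?thesis"
    then have h: "1/3 \<le> h" "h \<le> 1" by auto
    have "(h1 - h2)^2 * (1 - 3 * h) \<le> 0" and "(1 - h) * (1 + 3 * h^2) \<ge> 0"
      using h p by (simp_all add: mult_nonneg_nonpos)
    then have "(h1 - h2)^2 * (1 - 3 * h) = 0" "(1 - h) * (1 + 3 * h^2) = 0"
      using pell_triple_chord(2)[OF t] by linarith+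
    then show False using p by auto
  qed
qed

text \<open>
  The chord equations are solved for the half-chord \<open>(p, q) / 2\<close>; outside \<open>[1/3, 1]\<close> the number that
  has to be \<open>p^2\<close> is positive.
\<close>

lemma pell_triple_exists:
  assumes A: "k^2 - 3 * h^2 = 1" and "h \<noteq> 0" and "h < 1/3 \<or> 1 < h"
  shows "\<exists>h1 k1 h2 k2. pell_triple h k h1 k1 h2 k2 \<and> area h k h1 k1 h2 k2 \<noteq> 0"
proof -
  define r where "r = (1 - h) * (1 + 3 * h^2) / (1 - 3 * h)"
  have pos: "1 + 3 * h^2 > 0" by (simp add: add_pos_nonneg)
  have "r > 0"
    using assms(3)
  proof
    assume "1 < h"
    then show ?thesis unfolding r_def by (intro divide_neg_neg mult_neg_pos pos) auto
  qed (use pos in \<open>simp add: r_def\<close>)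
  define p where "p = sqrt r"
  have p2: "p^2 = r" and "p \<noteq> 0" using \<open>r > 0\<close> by (simp_all add: p_def)
  have "k \<noteq> 0" using A by (rule pell_nonzero)
  define q where "q = - 3 * (1 - h) * p / k"
  have kq: "k * q = - 3 * (1 - h) * p" using \<open>k \<noteq> 0\<close> by (simp add: q_def)
  have "1 - 3 * h \<noteq> 0" using assms(3) by auto
  then have chord: "(1 - h) * (1 + 3 * h^2) = p^2 * (1 - 3 * h)"
    unfolding p2 r_def by simp
  have k2: "k^2 = 1 + 3 * h^2" using A by simp
  have "k^2 * q^2 = 9 * (1 - h)^2 * p^2"
    unfolding power_mult_distrib[symmetric] kq by (simp add: algebra_simps power2_eq_square)
  then have "k^2 * (q^2 - 3 * p^2 - 6 * (1 - h)) = 6 * (p^2 * (1 - 3 * h) - (1 - h) * (1 + 3 * h^2))"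
    unfolding right_diff_distrib k2 by (simp add: algebra_simps power2_eq_square)
  then have q2: "q^2 = 3 * p^2 + 6 * (1 - h)"
    using chord \<open>k \<noteq> 0\<close> by simp
  \<comment> \<open>The two ends of the chord are treated at once, the sign \<open>\<sigma>\<close> distinguishing them.\<close>
  have eq: "((\<sigma> * q - k) / 2)^2 - 3 * ((1 - h + \<sigma> * p) / 2)^2 = 1" if "\<sigma>^2 = 1" for \<sigma>
  proof -
    have "4 * (((\<sigma> * q - k) / 2)^2 - 3 * ((1 - h + \<sigma> * p) / 2)^2) =
      \<sigma>^2 * (q^2 - 3 * p^2) + k^2 - 3 * (1 - h)^2 - 2 * \<sigma> * (k * q + 3 * (1 - h) * p)"
      by (simp add: field_simps power2_eq_square)
    also have "\<dots> = 4"
      unfolding q2 that kq k2 by (simp add: algebra_simps power2_eq_square)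
    finally show ?thesis by simp
  qed
  have t: "pell_triple h k ((1 - h + p) / 2) ((q - k) / 2) ((1 - h - p) / 2) ((- q - k) / 2)"
    using A eq[of 1] eq[of "-1"] unfolding pell_triple_def
    by (intro conjI) (simp_all add: diff_divide_distrib add_divide_distrib)
  moreover have "area h k ((1 - h + p) / 2) ((q - k) / 2) ((1 - h - p) / 2) ((- q - k) / 2) \<noteq> 0"
    unfolding pell_triple_area_nonzero_iff[OF t] using \<open>h \<noteq> 0\<close> \<open>p \<noteq> 0\<close> by simp
  ultimately show ?thesis by blast
qed

lemma pell_triple_unique:
  assumes t: "pell_triple h k h1 k1 h2 k2" and t': "pell_triple h k h1' k1' h2' k2'"
    and "h \<noteq> 1/3"
  shows "h1' = h1 \<and> k1' = k1 \<and> h2' = h2 \<and> k2' = k2 \<or>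
         h1' = h2 \<and> k1' = k2 \<and> h2' = h1 \<and> k2' = k1"
proof -
  have "k \<noteq> 0" using t pell_nonzero by (auto simp: pell_triple_def)
  have sums: "h1 + h2 = h1' + h2'" "k1 + k2 = k1' + k2'"
    using t t' by (auto simp: pell_triple_def)
  have "(h1 - h2)^2 * (1 - 3 * h) = (h1' - h2')^2 * (1 - 3 * h)"
    using pell_triple_chord(2)[OF t] pell_triple_chord(2)[OF t'] by linarith
  then have "h1' - h2' = h1 - h2 \<or> h1' - h2' = - (h1 - h2)"
    using \<open>h \<noteq> 1/3\<close> by (auto simp: power2_eq_iff)
  then show ?thesis
  proof
    assume p: "h1' - h2' = h1 - h2"
    then have "k * (k1' - k2') = k * (k1 - k2)"
      using pell_triple_chord(1)[OF t] pell_triple_chord(1)[OF t'] by simp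
    then show ?thesis using p sums \<open>k \<noteq> 0\<close> by auto
  next
    assume p: "h1' - h2' = - (h1 - h2)"
    have "k * (k1' - k2') = k * - (k1 - k2)"
      using pell_triple_chord(1)[OF t] pell_triple_chord(1)[OF t'] unfolding p
      by (simp add: algebra_simps)
    then have "k1' - k2' = - (k1 - k2)" using \<open>k \<noteq> 0\<close> mult_cancel_left by blast
    then show ?thesis using p sums by auto
  qed
qed

section \<open>Barycentric weights and squared sides\<close>

definition cubic_poly :: "real \<Rightarrow> real \<Rightarrow> real \<Rightarrow> real" where
  "cubic_poly x y z = x * (y + z)^2 + y * (x + z)^2 + z * (x + y)^2"

text \<open>
  The relations between the normalized weights \<open>x\<close>, \<open>y\<close>, \<open>z\<close> of the point \<open>(1, 2)\<close> and the halves \<open>\<alpha>\<close>, \<open>\<beta>\<close>,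
  \<open>\<gamma>\<close> of the squared sides, measured by \<open>k^2 - 3 h^2\<close>.  The fourth is the equation of the
  circumscribed hyperbola and the fifth is the vanishing of the Gram determinant of the vertices,
  regarded as vectors from the centre.
\<close>

definition weight_system :: "real \<Rightarrow> real \<Rightarrow> real \<Rightarrow> real \<Rightarrow> real \<Rightarrow> real \<Rightarrow> bool" where
  "weight_system x y z \<alpha> \<beta> \<gamma> \<longleftrightarrow>
     x + y + z = 1 \<and> \<alpha> + \<beta> + \<gamma> = 6 \<and>
     x * \<alpha> + y * \<beta> + z * \<gamma> = 0 \<and> y * z * \<alpha> + x * z * \<beta> + x * y * \<gamma> = 0 \<and>
     2 * (\<alpha> * \<beta> + \<beta> * \<gamma> + \<gamma> * \<alpha>) - (\<alpha>^2 + \<beta>^2 + \<gamma>^2) = 2 * \<alpha> * \<beta> * \<gamma>"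

lemma weight_system_rotate:
  "weight_system x y z \<alpha> \<beta> \<gamma> \<Longrightarrow> weight_system y z x \<beta> \<gamma> \<alpha>"
  by (simp add: weight_system_def algebra_simps)

text \<open>
  The identity by which the cubic enters: up to a factor, \<open>a\<close>, \<open>b\<close>, \<open>c\<close> are the squared sides expressed by
  the weights, and the left-hand side is the quadratic part of the Gram condition.
\<close>

lemma gram_cubic_factorization:
  fixes x y z :: real
  defines "a \<equiv> x * (y^2 - z^2)" and "b \<equiv> y * (z^2 - x^2)" and "c \<equiv> z * (x^2 - y^2)"
  shows "2 * (a * b + b * c + c * a) - (a^2 + b^2 + c^2) =
    (12 * x * y * z - cubic_poly x y z) * ((x + y) * (y + z) * (z + x))"
  unfolding a_def b_def c_def cubic_poly_def by algebra

text \<open>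
  The pairing of two vertices follows from the third, because the sum of the vertices is \<open>(1, 0)\<close>; in
  this way half the squared side opposite to \<open>(h, k)\<close> becomes \<open>3 (1 - h)\<close>.
\<close>

lemma pell_triple_weight_system:
  assumes t: "pell_triple h k h1 k1 h2 k2" and sum: "x + y + z = 1"
    and P: "x * h + y * h1 + z * h2 = 1" "x * k + y * k1 + z * k2 = 2"
  shows "weight_system x y z (3 * (1 - h)) (3 * (1 - h1)) (3 * (1 - h2))"
proof -
  have A: "k^2 - 3 * h^2 = 1" and B: "k1^2 - 3 * h1^2 = 1" and C: "k2^2 - 3 * h2^2 = 1"
    and h: "h + h1 + h2 = 1" and k: "k + k1 + k2 = 0"
    using t by (auto simp: pell_triple_def)
  \<comment> \<open>Expand \<open>Q\<close> on both sides of \<open>(h1, k1) + (h2, k2) = (1, 0) - (h, k)\<close>.\<close>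
  have pair: "k1 * k2 - 3 * h1 * h2 = 3 * h - 2" if "pell_triple h k h1 k1 h2 k2"
    for h k h1 k1 h2 k2 :: real
  proof -
    have A: "k^2 - 3 * h^2 = 1" and B: "k1^2 - 3 * h1^2 = 1" and C: "k2^2 - 3 * h2^2 = 1"
      and h: "h1 + h2 = 1 - h" and k: "k1 + k2 = - k"
      using that by (auto simp: pell_triple_def)
    have "2 * (k1 * k2 - 3 * h1 * h2) = (k1 + k2)^2 - 3 * (h1 + h2)^2 - 2"
      using B C by (simp add: algebra_simps power2_eq_square)
    then show ?thesis
      unfolding h k using A by (simp add: algebra_simps power2_eq_square)
  qed
  note bc = pair[OF t] and ca = pair[OF pell_triple_rotate[OF t]]
    and ab = pair[OF pell_triple_rotate[OF pell_triple_rotate[OF t]]]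
  \<comment> \<open>The value \<open>Q = 1\<close> at \<open>(1, 2)\<close>, written in the weights and compared with \<open>(x + y + z)^2 = 1\<close>.\<close>
  have "(x * k + y * k1 + z * k2)^2 - 3 * (x * h + y * h1 + z * h2)^2 =
      x^2 * (k^2 - 3 * h^2) + y^2 * (k1^2 - 3 * h1^2) + z^2 * (k2^2 - 3 * h2^2) +
      2 * (y * z * (k1 * k2 - 3 * h1 * h2) + x * z * (k2 * k - 3 * h2 * h)
         + x * y * (k * k1 - 3 * h * h1))"
    by (simp add: algebra_simps power2_eq_square)
  then have "1 = x^2 + y^2 + z^2 +
      2 * (y * z * (3 * h - 2) + x * z * (3 * h1 - 2) + x * y * (3 * h2 - 2))"
    unfolding P A B C ab bc ca by simp
  moreover have "1 = (x + y + z)^2" using sum by simp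
  ultimately have 1: "y * z * (3 * (1 - h)) + x * z * (3 * (1 - h1)) + x * y * (3 * (1 - h2)) = 0"
    by (simp add: algebra_simps power2_eq_square)
  have h2: "h2 = 1 - h - h1" using h by simp
  have 2: "2 * (3 * (1 - h) * (3 * (1 - h1)) + 3 * (1 - h1) * (3 * (1 - h2)) + 3 * (1 - h2) * (3 * (1 - h)))
      - ((3 * (1 - h))^2 + (3 * (1 - h1))^2 + (3 * (1 - h2))^2) =
      2 * (3 * (1 - h)) * (3 * (1 - h1)) * (3 * (1 - h2))"
    using pell_triple_chord(2)[OF t] unfolding h2
    by (simp add: algebra_simps power2_eq_square)
  have "3 * (1 - h) + 3 * (1 - h1) + 3 * (1 - h2) = 6" using h by simp
  moreover have "x * (3 * (1 - h)) + y * (3 * (1 - h1)) + z * (3 * (1 - h2)) = 0"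
    using P(1) sum by (simp add: algebra_simps)
  ultimately show ?thesis
    unfolding weight_system_def using sum 1 2 by blast
qed

text \<open>
  The two homogeneous equations make \<open>(\<alpha>, \<beta>, \<gamma>)\<close> proportional to the cross product of \<open>(x, y, z)\<close> and
  \<open>(y z, x z, x y)\<close>, and the sum \<open>6\<close> fixes the factor.
\<close>

lemma weight_system_solution:
  assumes "weight_system x y z \<alpha> \<beta> \<gamma>"
  shows "(x - y) * (y - z) * (z - x) * \<alpha> = 6 * (x * (y^2 - z^2))"
proof -
  have s: "\<alpha> + \<beta> + \<gamma> = 6" and 1: "x * \<alpha> + y * \<beta> + z * \<gamma> = 0"
    and 2: "y * z * \<alpha> + x * z * \<beta> + x * y * \<gamma> = 0"
    using assms by (auto simp: weight_system_def)
  have "\<alpha> * (y * (z^2 - x^2)) - \<beta> * (x * (y^2 - z^2)) =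
      z * (y * z * \<alpha> + x * z * \<beta> + x * y * \<gamma>) - x * y * (x * \<alpha> + y * \<beta> + z * \<gamma>)"
    by (simp add: algebra_simps power2_eq_square)
  moreover have "\<alpha> * (z * (x^2 - y^2)) - \<gamma> * (x * (y^2 - z^2)) =
      x * z * (x * \<alpha> + y * \<beta> + z * \<gamma>) - y * (y * z * \<alpha> + x * z * \<beta> + x * y * \<gamma>)"
    by (simp add: algebra_simps power2_eq_square)
  ultimately have "\<alpha> * (x * (y^2 - z^2) + y * (z^2 - x^2) + z * (x^2 - y^2)) =
      (\<alpha> + \<beta> + \<gamma>) * (x * (y^2 - z^2))"
    unfolding 1 2 by (simp add: algebra_simps)
  then show ?thesis unfolding s by (simp add: algebra_simps power2_eq_square)
qed

text \<open>
  If \<open>x = y\<close>, the solution formula leaves the centroid, a vertex, and \<open>(1, 1, -1)\<close>; the first does not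
  satisfy the linear equations, and at the other two a side has length zero.
\<close>

lemma weight_system_distinct:
  assumes w: "weight_system x y z \<alpha> \<beta> \<gamma>" and nz: "\<alpha> \<noteq> 0" "\<beta> \<noteq> 0" "\<gamma> \<noteq> 0"
  shows "x \<noteq> y"
proof
  assume "x = y"
  have x: "2 * x + z = 1" "x * (\<alpha> + \<beta>) + z * \<gamma> = 0" "\<alpha> + \<beta> + \<gamma> = 6"
    using w \<open>x = y\<close> by (auto simp: weight_system_def algebra_simps)
  have "6 * (x * (x^2 - z^2)) = 0"
    using weight_system_solution[OF w] \<open>x = y\<close> by simp
  then consider "x = 0" | "x = z" | "z = - x" by (auto simp: power2_eq_iff)
  then show False
  proof cases
    case 1 then show False using x nz by simp
  next
    case 2
    then have "x * (\<alpha> + \<beta> + \<gamma>) = 0" using x(2) by (simp add: algebra_simps)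
    then show False using x 2 by simp
  next
    case 3
    then have "x = 1" using x by simp
    then have c: "\<gamma> = 3" and s: "\<alpha> + \<beta> = 3" using x 3 by auto
    have "2 * (\<alpha> * \<beta> + \<beta> * \<gamma> + \<gamma> * \<alpha>) - (\<alpha>^2 + \<beta>^2 + \<gamma>^2) = 2 * \<alpha> * \<beta> * \<gamma>"
      using w by (simp add: weight_system_def)
    then have "\<alpha> * \<beta> = 0"
      unfolding c using s by algebra
    then show False using nz by simp
  qed
qed

text \<open>
  Substituting the solution formula into the Gram condition leaves the cubic times
  \<open>(x - y) (y - z) (z - x)\<close> and \<open>(x + y) (y + z) (z + x)\<close>, and both of these are nonzero.
\<close>

lemma weight_system_cubic:
  assumes w: "weight_system x y z \<alpha> \<beta> \<gamma>" and nz: "\<alpha> \<noteq> 0" "\<beta> \<noteq> 0" "\<gamma> \<noteq> 0"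
  shows "cubic_poly x y z = 0" "x * y * z \<noteq> 0" "(x - y) * (y - z) * (z - x) \<noteq> 0"
proof -
  note w2 = weight_system_rotate[OF w]
  note w3 = weight_system_rotate[OF w2]
  define \<delta> where "\<delta> = (x - y) * (y - z) * (z - x)"
  define a where "a = x * (y^2 - z^2)"
  define b where "b = y * (z^2 - x^2)"
  define c where "c = z * (x^2 - y^2)"
  define m where "m = (x + y) * (y + z) * (z + x)"
  have "x \<noteq> y" "y \<noteq> z" "z \<noteq> x"
    using weight_system_distinct[OF w] weight_system_distinct[OF w2] weight_system_distinct[OF w3] nz
    by auto
  then show "(x - y) * (y - z) * (z - x) \<noteq> 0" by simp
  then have "\<delta> \<noteq> 0" by (simp add: \<delta>_def)
  have sol: "\<delta> * \<alpha> = 6 * a" "\<delta> * \<beta> = 6 * b" "\<delta> * \<gamma> = 6 * c"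
    using weight_system_solution[OF w] weight_system_solution[OF w2] weight_system_solution[OF w3]
    unfolding \<delta>_def a_def b_def c_def by (simp_all add: mult_ac)
  then have abc: "a \<noteq> 0" "b \<noteq> 0" "c \<noteq> 0" using \<open>\<delta> \<noteq> 0\<close> nz by force+
  then show "x * y * z \<noteq> 0" by (auto simp: a_def b_def c_def)
  have "y^2 - z^2 = (y + z) * (y - z)" "z^2 - x^2 = (z + x) * (z - x)" "x^2 - y^2 = (x + y) * (x - y)"
    by (simp_all add: algebra_simps power2_eq_square)
  then have "m \<noteq> 0" and abc_eq: "a * b * c = \<delta> * (x * y * z) * m"
    using abc by (auto simp: a_def b_def c_def m_def \<delta>_def)
  have "2 * (\<alpha> * \<beta> + \<beta> * \<gamma> + \<gamma> * \<alpha>) - (\<alpha>^2 + \<beta>^2 + \<gamma>^2) = 2 * \<alpha> * \<beta> * \<gamma>"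
    using w by (simp add: weight_system_def)
  then have "\<delta> * (2 * ((\<delta>*\<alpha>) * (\<delta>*\<beta>) + (\<delta>*\<beta>) * (\<delta>*\<gamma>) + (\<delta>*\<gamma>) * (\<delta>*\<alpha>)) - ((\<delta>*\<alpha>)^2 + (\<delta>*\<beta>)^2 + (\<delta>*\<gamma>)^2))
      = 2 * (\<delta>*\<alpha>) * (\<delta>*\<beta>) * (\<delta>*\<gamma>)"
    by algebra
  then have "\<delta> * (2 * (a * b + b * c + c * a) - (a^2 + b^2 + c^2)) = 12 * (a * b * c)"
    unfolding sol by (simp add: algebra_simps power2_eq_square)
  then have "\<delta> * ((12 * x * y * z - cubic_poly x y z) * m) = 12 * (\<delta> * (x * y * z) * m)"
    unfolding abc_eq using gram_cubic_factorization[of x y z] by (simp add: a_def b_def c_def m_def)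
  then have "\<delta> * m * cubic_poly x y z = 0" by (simp add: algebra_simps)
  then show "cubic_poly x y z = 0" using \<open>\<delta> \<noteq> 0\<close> \<open>m \<noteq> 0\<close> by simp
qed

text \<open>
  The computation of \<open>weight_system_cubic\<close> read backwards: the solution formula defines the squared
  sides.  They are nonzero because on the cubic \<open>y + z = 0\<close> forces \<open>x y = 0\<close>.
\<close>

lemma cubic_imp_weight_system:
  assumes sum: "x + y + z = 1" and K: "cubic_poly x y z = 0" and "x * y * z \<noteq> 0"
    and "(x - y) * (y - z) * (z - x) \<noteq> 0"
  shows "\<exists>\<alpha> \<beta> \<gamma>. weight_system x y z \<alpha> \<beta> \<gamma> \<and> \<alpha> \<noteq> 0 \<and> \<beta> \<noteq> 0 \<and> \<gamma> \<noteq> 0"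
proof -
  define \<delta> where "\<delta> = (x - y) * (y - z) * (z - x)"
  define a where "a = x * (y^2 - z^2)"
  define b where "b = y * (z^2 - x^2)"
  define c where "c = z * (x^2 - y^2)"
  define m where "m = (x + y) * (y + z) * (z + x)"
  have "\<delta> \<noteq> 0" using assms by (simp add: \<delta>_def)
  have nz: "x \<noteq> 0" "y \<noteq> 0" "z \<noteq> 0" "x \<noteq> y" "y \<noteq> z" "z \<noteq> x" using assms by auto
  have opp: "v + w \<noteq> 0" if "cubic_poly u v w = 0" "u \<noteq> 0" "v \<noteq> 0" for u v w
  proof
    assume "v + w = 0"
    then have "w = - v" by simp
    then have "u * v^2 = 0"
      using that by (simp add: cubic_poly_def algebra_simps power2_eq_square)
    then show False using that by simp
  qed
  have "cubic_poly y z x = 0" "cubic_poly z x y = 0"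
    using K by (simp_all add: cubic_poly_def add_ac)
  then have pos: "y + z \<noteq> 0" "z + x \<noteq> 0" "x + y \<noteq> 0" using opp K nz by blast+
  have fac: "y^2 - z^2 = (y + z) * (y - z)" "z^2 - x^2 = (z + x) * (z - x)" "x^2 - y^2 = (x + y) * (x - y)"
    by (simp_all add: algebra_simps power2_eq_square)
  have abc: "a \<noteq> 0" "b \<noteq> 0" "c \<noteq> 0"
    using pos nz unfolding a_def b_def c_def fac by auto
  have abc_eq: "a * b * c = \<delta> * (x * y * z) * m"
    unfolding a_def b_def c_def m_def \<delta>_def fac by (simp add: mult_ac)
  have sum_abc: "a + b + c = \<delta>"
    unfolding a_def b_def c_def \<delta>_def by (simp add: algebra_simps power2_eq_square)
  have gram: "2 * (a * b + b * c + c * a) - (a^2 + b^2 + c^2) = 12 * x * y * z * m"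
    using gram_cubic_factorization[of x y z] K by (simp add: a_def b_def c_def m_def)
  have "weight_system x y z (6 * a / \<delta>) (6 * b / \<delta>) (6 * c / \<delta>)"
    unfolding weight_system_def
  proof (intro conjI)
    show "x + y + z = 1" by fact
    show "6 * a / \<delta> + 6 * b / \<delta> + 6 * c / \<delta> = 6"
      using \<open>\<delta> \<noteq> 0\<close> sum_abc by (simp add: field_simps)
    have "x * a + y * b + z * c = 0" "y * z * a + x * z * b + x * y * c = 0"
      unfolding a_def b_def c_def by (simp_all add: algebra_simps power2_eq_square)
    then show "x * (6 * a / \<delta>) + y * (6 * b / \<delta>) + z * (6 * c / \<delta>) = 0"
      "y * z * (6 * a / \<delta>) + x * z * (6 * b / \<delta>) + x * y * (6 * c / \<delta>) = 0"
      using \<open>\<delta> \<noteq> 0\<close> by (simp_all add: field_simps)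
    have "2 * (6 * a / \<delta> * (6 * b / \<delta>) + 6 * b / \<delta> * (6 * c / \<delta>) + 6 * c / \<delta> * (6 * a / \<delta>)) -
        ((6 * a / \<delta>)^2 + (6 * b / \<delta>)^2 + (6 * c / \<delta>)^2) =
        36 * (2 * (a * b + b * c + c * a) - (a^2 + b^2 + c^2)) / \<delta>^2"
      using \<open>\<delta> \<noteq> 0\<close> by (simp add: field_simps power2_eq_square)
    also have "\<dots> = 432 * (\<delta> * (x * y * z) * m) / \<delta>^3"
      unfolding gram using \<open>\<delta> \<noteq> 0\<close> by (simp add: power3_eq_cube power2_eq_square)
    also have "\<dots> = 2 * (6 * a / \<delta>) * (6 * b / \<delta>) * (6 * c / \<delta>)"
      unfolding abc_eq[symmetric] by (simp add: power3_eq_cube)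
    finally show "2 * (6 * a / \<delta> * (6 * b / \<delta>) + 6 * b / \<delta> * (6 * c / \<delta>) + 6 * c / \<delta> * (6 * a / \<delta>)) -
        ((6 * a / \<delta>)^2 + (6 * b / \<delta>)^2 + (6 * c / \<delta>)^2) =
        2 * (6 * a / \<delta>) * (6 * b / \<delta>) * (6 * c / \<delta>)" .
  qed
  then show ?thesis using abc \<open>\<delta> \<noteq> 0\<close> by (metis divide_eq_0_iff mult_eq_0_iff zero_neq_numeral)
qed

text \<open>
  The point with coordinates \<open>h = 1 - \<alpha> / 3\<close> and \<open>k = 3 x h - 1\<close> is the vertex with weight \<open>x\<close>.  For
  the proof everything but \<open>x\<close> and \<open>\<alpha>\<close> is eliminated: the sums and products of \<open>y, z\<close> and of \<open>\<beta>, \<gamma>\<close> are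
  known, hence their squared differences, and the product of these two is compared with the square of
  \<open>(y - z) (\<beta> - \<gamma>)\<close>, which the linear equations give directly.
\<close>

lemma weight_system_on_hyperbola:
  assumes w: "weight_system x y z \<alpha> \<beta> \<gamma>" and "\<alpha> \<noteq> 0"
  shows "(x * (3 - \<alpha>) - 1)^2 - 3 * (1 - \<alpha> / 3)^2 = 1"
proof -
  define s where "s = 3 - \<alpha>"
  define t where "t = y * \<gamma> + z * \<beta>"
  have \<alpha>: "\<alpha> = 3 - s" by (simp add: s_def)
  have sum: "y + z = 1 - x" and s6: "\<beta> + \<gamma> = 3 + s"
    and 1: "y * \<beta> + z * \<gamma> = - (x * \<alpha>)" and 2: "\<alpha> * (y * z) = - (x * t)"
    and g: "2 * (\<alpha> * \<beta> + \<beta> * \<gamma> + \<gamma> * \<alpha>) - (\<alpha>^2 + \<beta>^2 + \<gamma>^2) = 2 * \<alpha> * \<beta> * \<gamma>"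
    using w by (auto simp: weight_system_def s_def t_def algebra_simps)
  have "(y + z) * (\<beta> + \<gamma>) = (y * \<beta> + z * \<gamma>) + t" by (simp add: t_def algebra_simps)
  then have t: "t = 3 + s - 2 * x * s"
    unfolding sum s6 1 by (simp add: s_def algebra_simps)
  have "(\<beta> + \<gamma> - \<alpha>)^2 = 2 * (\<beta> * \<gamma>) * (2 - \<alpha>)"
    using g by (simp add: algebra_simps power2_eq_square)
  moreover have "\<beta> + \<gamma> - \<alpha> = 2 * s" and "2 - \<alpha> = s - 1"
    using s6 by (simp_all add: s_def)
  ultimately have bc: "\<beta> * \<gamma> * (s - 1) = 2 * s^2"
    by (simp add: power_mult_distrib)
  have dy: "\<alpha> * (y - z)^2 = \<alpha> * (1 - x)^2 + 4 * x * t"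
    using 2 unfolding sum[symmetric] by (simp add: algebra_simps power2_eq_square)
  have "(s - 1) * (\<beta> - \<gamma>)^2 = (s - 1) * (\<beta> + \<gamma>)^2 - 4 * (\<beta> * \<gamma> * (s - 1))"
    by (simp add: algebra_simps power2_eq_square)
  then have db: "(s - 1) * (\<beta> - \<gamma>)^2 = - \<alpha> * (s^2 + 3)"
    unfolding bc s6 \<alpha> by (simp add: algebra_simps power2_eq_square)
  have "(y - z) * (\<beta> - \<gamma>) = - (x * \<alpha>) - t"
    unfolding 1[symmetric] by (simp add: t_def algebra_simps)
  then have "\<alpha> * ((s - 1) * (x * \<alpha> + t)^2) = (\<alpha> * (y - z)^2) * ((s - 1) * (\<beta> - \<gamma>)^2)"
    by algebra
  also have "\<dots> = \<alpha> * (- (s^2 + 3) * (\<alpha> * (1 - x)^2 + 4 * x * t))"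
    unfolding dy db by (simp only: mult_ac minus_mult_left[symmetric] minus_mult_right[symmetric])
  finally have "(s - 1) * (x * \<alpha> + t)^2 = - (s^2 + 3) * (\<alpha> * (1 - x)^2 + 4 * x * t)"
    using \<open>\<alpha> \<noteq> 0\<close> by simp
  then have "s * (3 * s * x^2 - 6 * x - s) = 0"
    unfolding t \<alpha> by algebra
  then have "(x * s - 1)^2 - s^2 / 3 = 1"
    by (simp add: algebra_simps power2_eq_square)
  moreover have "3 * (1 - \<alpha> / 3)^2 = s^2 / 3"
    by (simp add: s_def power2_eq_square field_simps)
  ultimately show ?thesis by (simp add: s_def)
qed

text \<open>
  The three vertices come from \<open>weight_system_on_hyperbola\<close>; the triangle is nondegenerate because no
  squared side vanishes.
\<close>

lemma weight_system_pell_triple: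
  assumes w: "weight_system x y z \<alpha> \<beta> \<gamma>" and nz: "\<alpha> \<noteq> 0" "\<beta> \<noteq> 0" "\<gamma> \<noteq> 0"
  shows "\<exists>h k h1 k1 h2 k2. pell_triple h k h1 k1 h2 k2 \<and> area h k h1 k1 h2 k2 \<noteq> 0 \<and>
    x * h + y * h1 + z * h2 = 1 \<and> x * k + y * k1 + z * k2 = 2"
proof (intro exI conjI)
  define kk where "kk u v = u * (3 - v) - 1" for u v :: real
  let ?h = "1 - \<alpha> / 3" and ?h1 = "1 - \<beta> / 3" and ?h2 = "1 - \<gamma> / 3"
  have eqs: "x + y + z = 1" "\<alpha> + \<beta> + \<gamma> = 6" "x * \<alpha> + y * \<beta> + z * \<gamma> = 0"
    "y * z * \<alpha> + x * z * \<beta> + x * y * \<gamma> = 0"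
    using w by (auto simp: weight_system_def)
  show "x * ?h + y * ?h1 + z * ?h2 = 1"
    using eqs by (simp add: field_simps)
  show P: "x * kk x \<alpha> + y * kk y \<beta> + z * kk z \<gamma> = 2"
    unfolding kk_def using eqs by algebra
  have "kk x \<alpha> + kk y \<beta> + kk z \<gamma> = 0"
    unfolding kk_def using eqs by (simp add: algebra_simps)
  moreover have "?h + ?h1 + ?h2 = 1" using eqs(2) by (simp add: field_simps)
  moreover note weight_system_on_hyperbola[OF w nz(1)]
    weight_system_on_hyperbola[OF weight_system_rotate[OF w] nz(2)]
    weight_system_on_hyperbola[OF weight_system_rotate[OF weight_system_rotate[OF w]] nz(3)]
  ultimately show t: "pell_triple ?h (kk x \<alpha>) ?h1 (kk y \<beta>) ?h2 (kk z \<gamma>)"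
    by (simp add: pell_triple_def kk_def)
  have chord: "(1 - ?h) * (1 + 3 * ?h^2) = (?h1 - ?h2)^2 * (1 - 3 * ?h)"
    by (rule pell_triple_chord(2)[OF t])
  have "1 + 3 * ?h^2 \<noteq> 0" by (smt (verit) zero_le_power2)
  have "?h1 \<noteq> ?h2"
    using chord \<open>1 + 3 * ?h^2 \<noteq> 0\<close> nz(1) by auto
  moreover have "?h \<noteq> 0"
  proof
    assume h: "?h = 0"
    then have "(?h1 - ?h2)^2 = 1" using chord by simp
    then have "?h1 - ?h2 = 1 \<or> ?h1 - ?h2 = - 1" by (simp add: power2_eq_1_iff)
    moreover have "?h1 + ?h2 = 1" using h eqs(2) by simp
    ultimately show False using nz by auto
  qed
  ultimately show "area ?h (kk x \<alpha>) ?h1 (kk y \<beta>) ?h2 (kk z \<gamma>) \<noteq> 0"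
    unfolding pell_triple_area_nonzero_iff[OF t] by simp
qed

section \<open>Triangles and affine maps of the plane\<close>

definition det2 :: "real^2 \<Rightarrow> real^2 \<Rightarrow> real" where
  "det2 a b = a $ 1 * b $ 2 - a $ 2 * b $ 1"

lemma det2_simps:
  "det2 (a + b) c = det2 a c + det2 b c" "det2 a (b + c) = det2 a b + det2 a c"
  "det2 (a - b) c = det2 a c - det2 b c" "det2 a (b - c) = det2 a b - det2 a c"
  "det2 (r *\<^sub>R a) c = r * det2 a c" "det2 a (r *\<^sub>R c) = r * det2 a c"
  "det2 a a = 0" "det2 0 a = 0" "det2 a 0 = 0"
  by (simp_all add: det2_def algebra_simps)

lemma det2_swap: "det2 b a = - det2 a b"
  by (simp add: det2_def)

lemma det2_expand:
  assumes "det2 u w \<noteq> 0"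
  shows "v = (det2 v w / det2 u w) *\<^sub>R u + (det2 u v / det2 u w) *\<^sub>R w"
proof -
  have "det2 u w * v $ i = det2 v w * u $ i + det2 u v * w $ i" for i
    using exhaust_2[of i] by (auto simp: det2_def algebra_simps)
  then show ?thesis
    using assms by (simp add: vec_eq_iff field_simps)
qed

lemma collinear_origin_iff_det2: "collinear {0, a, b} \<longleftrightarrow> det2 a b = 0"
proof
  assume "collinear {0, a, b}"
  then show "det2 a b = 0"
    by (auto simp: collinear_lemma det2_simps)
next
  assume 0: "det2 a b = 0"
  show "collinear {0, a, b}"
  proof (cases "a = 0")
    case False
    then consider "a $ 1 \<noteq> 0" | "a $ 2 \<noteq> 0" by (auto simp: vec_eq_iff forall_2)
    then have "\<exists>c. b = c *\<^sub>R a"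
    proof cases
      case 1
      then have "b = (b $ 1 / a $ 1) *\<^sub>R a"
        using 0 by (simp add: vec_eq_iff forall_2 det2_def field_simps)
      then show ?thesis by blast
    next
      case 2
      then have "b = (b $ 2 / a $ 2) *\<^sub>R a"
        using 0 by (simp add: vec_eq_iff forall_2 det2_def field_simps)
      then show ?thesis by blast
    qed
    then show ?thesis by (simp add: collinear_lemma)
  qed (simp add: collinear_lemma)
qed

lemma is_triangle_iff_det2: "is_triangle A B C \<longleftrightarrow> det2 (B - A) (C - A) \<noteq> 0"
proof -
  have "collinear {A, B, C} \<longleftrightarrow> collinear {B, A, C}" by (simp add: insert_commute)
  also have "\<dots> \<longleftrightarrow> collinear {0, B - A, C - A}" by (rule collinear_3) simp
  finally show ?thesis by (simp add: is_triangle_def collinear_origin_iff_det2)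
qed

lemma barycentric_weights_exist:
  assumes "is_triangle A B C"
  obtains x y z where "x + y + z = 1" "X = x *\<^sub>R A + y *\<^sub>R B + z *\<^sub>R C"
proof -
  define y where "y = det2 (X - A) (C - A) / det2 (B - A) (C - A)"
  define z where "z = det2 (B - A) (X - A) / det2 (B - A) (C - A)"
  have "X - A = y *\<^sub>R (B - A) + z *\<^sub>R (C - A)"
    unfolding y_def z_def using assms by (intro det2_expand) (simp add: is_triangle_iff_det2)
  then have "X = (1 - y - z) *\<^sub>R A + y *\<^sub>R B + z *\<^sub>R C"
    by (simp add: algebra_simps)
  moreover have "(1 - y - z) + y + z = 1" by simp
  ultimately show thesis using that by blast
qed

lemma triangle_weights_zero:
  assumes "is_triangle A B C" and "x *\<^sub>R A + y *\<^sub>R B + z *\<^sub>R C = 0" and "x + y + z = 0"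
  shows "x = 0 \<and> y = 0 \<and> z = 0"
proof -
  have "y *\<^sub>R (B - A) + z *\<^sub>R (C - A) =
      (x *\<^sub>R A + y *\<^sub>R B + z *\<^sub>R C) - (x + y + z) *\<^sub>R A"
    by (simp add: algebra_simps)
  then have "y *\<^sub>R (B - A) + z *\<^sub>R (C - A) = 0"
    using assms(2,3) by simp
  then have "det2 (y *\<^sub>R (B - A) + z *\<^sub>R (C - A)) (C - A) = 0"
    and "det2 (B - A) (y *\<^sub>R (B - A) + z *\<^sub>R (C - A)) = 0"
    by (simp_all add: det2_simps(8,9))
  then have "y * det2 (B - A) (C - A) = 0" "z * det2 (B - A) (C - A) = 0"
    by (simp_all add: det2_simps(1,2,5,6,7))
  then show ?thesis using assms by (simp add: is_triangle_iff_det2)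
qed

lemma affine_map_combination:
  assumes "affine_map f" and "x + y + z = 1"
  shows "f (x *\<^sub>R A + y *\<^sub>R B + z *\<^sub>R C) = x *\<^sub>R f A + y *\<^sub>R f B + z *\<^sub>R f C"
proof -
  obtain L c where L: "linear L" "f = (\<lambda>X. L X + c)"
    using assms(1) by (auto simp: affine_map_def)
  have "x *\<^sub>R c + y *\<^sub>R c + z *\<^sub>R c = c"
    using assms(2) by (simp flip: scaleR_add_left)
  then show ?thesis
    using L by (simp add: linear_add linear_scale algebra_simps)
qed

lemma affine_map_between_triangles:
  assumes "is_triangle A B C" and "is_triangle A' B' C'"
  obtains f where "affine_map f" "f A = A'" "f B = B'" "f C = C'"
proof -
  let ?b = "B - A" and ?c = "C - A" and ?b' = "B' - A'" and ?c' = "C' - A'"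
  have d: "det2 ?b ?c \<noteq> 0" "det2 ?b' ?c' \<noteq> 0"
    using assms by (simp_all add: is_triangle_iff_det2)
  define L where "L v = (det2 v ?c / det2 ?b ?c) *\<^sub>R ?b' + (det2 ?b v / det2 ?b ?c) *\<^sub>R ?c'" for v
  have lin: "linear L"
    by (rule linearI) (simp_all add: L_def det2_simps(1,2,5,6) add_divide_distrib scaleR_add_left
        scaleR_add_right)
  have "inj L"
    unfolding linear_injective_0[OF lin]
  proof (intro allI impI)
    fix v assume "L v = 0"
    then have "det2 (L v) ?c' = 0" "det2 ?b' (L v) = 0"
      by (simp_all add: det2_simps(8,9))
    then have "det2 v ?c = 0" "det2 ?b v = 0"
      using d by (simp_all only: L_def det2_simps(1,2,5,6,7)) simp_all
    then show "v = 0"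
      using det2_expand[OF d(1), of v] by simp
  qed
  then have "bij L"
    using lin linear_injective_imp_surjective by (auto simp: bij_def)
  define f where "f X = L X + (A' - L A)" for X
  have Lb: "L B - L A = ?b'" "L C - L A = ?c'"
    using d unfolding linear_diff[OF lin, symmetric] by (simp_all add: L_def det2_simps(7))
  have "affine_map f"
    unfolding affine_map_def f_def using lin \<open>bij L\<close> by blast
  moreover have "f A = A'" "f B = B'" "f C = C'"
    using Lb by (simp_all add: f_def algebra_simps)
  ultimately show thesis using that by blast
qed

section \<open>The cubic without its twelve torsion points\<close>

lemma pt_eq_iff: "pt X = pt Y \<longleftrightarrow> X = Y"
proof
  assume "pt X = pt Y"
  then have "(X, 1) \<in> span {(Y, 1::real)}"
    unfolding pt_def by (metis insertI1 span_base)
  then show "X = Y" by (auto simp: span_singleton)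
qed simp

lemma pt_not_at_infinity: "pt X \<notin> line_at_infinity"
proof
  assume "pt X \<in> line_at_infinity"
  then obtain d where "span {(X, 1::real)} = span {(d, 0)}"
    by (auto simp: pt_def line_at_infinity_def)
  then have "(X, 1) \<in> span {(d, 0::real)}"
    by (metis insertI1 span_base)
  then show False by (auto simp: span_singleton)
qed

lemma span_scaleR_singleton:
  assumes "c \<noteq> 0"
  shows "span {c *\<^sub>R v} = span {v}"
proof -
  have "range (\<lambda>r. r *\<^sub>R c *\<^sub>R v) = range (\<lambda>r. r *\<^sub>R v)"
  proof (intro equalityI subsetI)
    fix a assume "a \<in> range (\<lambda>r. r *\<^sub>R v)"
    then obtain r where "a = r *\<^sub>R v" by blast
    then have "a = (r / c) *\<^sub>R c *\<^sub>R v" using assms by simp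
    then show "a \<in> range (\<lambda>r. r *\<^sub>R c *\<^sub>R v)" by blast
  qed auto
  then show ?thesis by (simp add: span_singleton)
qed

lemma bary_scale:
  assumes "c \<noteq> 0"
  shows "bary A B C (c * x) (c * y) (c * z) = bary A B C x y z"
proof -
  have "((c * x) *\<^sub>R A + (c * y) *\<^sub>R B + (c * z) *\<^sub>R C, c * x + c * y + c * z) =
      c *\<^sub>R (x *\<^sub>R A + y *\<^sub>R B + z *\<^sub>R C, x + y + z)"
    by (simp add: algebra_simps)
  then show ?thesis unfolding bary_def using span_scaleR_singleton[OF assms] by metis
qed

lemma bary_eq_imp_proportional:
  assumes tri: "is_triangle A B C" and eq: "bary A B C x y z = bary A B C x' y' z'"
  shows "\<exists>c. x = c * x' \<and> y = c * y' \<and> z = c * z'"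
proof -
  have "(x *\<^sub>R A + y *\<^sub>R B + z *\<^sub>R C, x + y + z) \<in>
      span {(x' *\<^sub>R A + y' *\<^sub>R B + z' *\<^sub>R C, x' + y' + z')}"
    using eq unfolding bary_def by (metis insertI1 span_base)
  then obtain c where c: "x *\<^sub>R A + y *\<^sub>R B + z *\<^sub>R C = c *\<^sub>R (x' *\<^sub>R A + y' *\<^sub>R B + z' *\<^sub>R C)"
    "x + y + z = c * (x' + y' + z')"
    by (auto simp: span_singleton)
  have "(x - c * x') *\<^sub>R A + (y - c * y') *\<^sub>R B + (z - c * z') *\<^sub>R C =
      (x *\<^sub>R A + y *\<^sub>R B + z *\<^sub>R C) - c *\<^sub>R (x' *\<^sub>R A + y' *\<^sub>R B + z' *\<^sub>R C)"
    by (simp add: algebra_simps)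
  also have "\<dots> = 0" using c(1) by simp
  finally have "(x - c * x') *\<^sub>R A + (y - c * y') *\<^sub>R B + (z - c * z') *\<^sub>R C = 0" .
  moreover have "(x - c * x') + (y - c * y') + (z - c * z') = 0"
    using c(2) by (simp add: algebra_simps)
  ultimately have "x - c * x' = 0 \<and> y - c * y' = 0 \<and> z - c * z' = 0"
    by (rule triangle_weights_zero[OF tri])
  then show ?thesis by auto
qed

lemma T12_I:
  assumes "c \<noteq> 0"
  shows "bary A B C c 0 0 \<in> T12 A B C" "bary A B C 0 c 0 \<in> T12 A B C" "bary A B C 0 0 c \<in> T12 A B C"
    "bary A B C 0 c (- c) \<in> T12 A B C" "bary A B C c 0 (- c) \<in> T12 A B C" "bary A B C c (- c) 0 \<in> T12 A B C"
    "t^2 + 4 * t + 1 = 0 \<Longrightarrow> bary A B C c (c * t) (c * t) \<in> T12 A B C"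
    "t^2 + 4 * t + 1 = 0 \<Longrightarrow> bary A B C (c * t) c (c * t) \<in> T12 A B C"
    "t^2 + 4 * t + 1 = 0 \<Longrightarrow> bary A B C (c * t) (c * t) c \<in> T12 A B C"
proof -
  note s = bary_scale[OF assms, of A B C]
  show "bary A B C c 0 0 \<in> T12 A B C" "bary A B C 0 c 0 \<in> T12 A B C" "bary A B C 0 0 c \<in> T12 A B C"
    using s[of 1 0 0] s[of 0 1 0] s[of 0 0 1] by (simp_all add: T12_def)
  show "bary A B C 0 c (- c) \<in> T12 A B C" "bary A B C c 0 (- c) \<in> T12 A B C" "bary A B C c (- c) 0 \<in> T12 A B C"
    using s[of 0 1 "-1"] s[of 1 0 "-1"] s[of 1 "-1" 0] by (simp_all add: T12_def)
  assume "t^2 + 4 * t + 1 = 0"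
  then have "(t + 2)^2 = (sqrt 3)^2" by (simp add: algebra_simps power2_eq_square)
  then have "t + 2 = sqrt 3 \<or> t + 2 = - sqrt 3" by (simp only: power2_eq_iff)
  then have "t \<in> {-2 + sqrt 3, -2 - sqrt 3}" by auto
  then have "bary A B C 1 t t \<in> T12 A B C" "bary A B C t 1 t \<in> T12 A B C" "bary A B C t t 1 \<in> T12 A B C"
    unfolding T12_def by blast+
  then show "bary A B C c (c * t) (c * t) \<in> T12 A B C" "bary A B C (c * t) c (c * t) \<in> T12 A B C"
    "bary A B C (c * t) (c * t) c \<in> T12 A B C"
    using s[of 1 t t] s[of t 1 t] s[of t t 1] by simp_all
qed

lemma T12_weights:
  assumes "P \<in> T12 A B C"
  shows "\<exists>x y z. P = bary A B C x y z \<and> x * y * z * ((x - y) * (y - z) * (z - x)) = 0"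
proof -
  define S where "S = {bary A B C x y z | x y z. x * y * z * ((x - y) * (y - z) * (z - x)) = 0}"
  have S: "bary A B C x y z \<in> S" if "x * y * z * ((x - y) * (y - z) * (z - x)) = 0" for x y z
    using that unfolding S_def by blast
  have "T12 A B C \<subseteq> S"
    unfolding T12_def by (auto intro!: S)
  then show ?thesis using assms unfolding S_def by blast
qed

lemma cubic_poly_sym:
  "cubic_poly y x z = cubic_poly x y z" "cubic_poly x z y = cubic_poly x y z"
  by (simp_all add: cubic_poly_def algebra_simps)

lemma cubic_poly_zero_weight:
  assumes "cubic_poly 0 y z = 0"
  shows "y = 0 \<or> z = 0 \<or> z = - y"
proof -
  have "y * z * (y + z) = 0" using assms by (simp add: cubic_poly_def algebra_simps power2_eq_square)
  then show ?thesis by auto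
qed

lemma cubic_poly_equal_weights:
  assumes "cubic_poly x y y = 0" and "x \<noteq> 0" "y \<noteq> 0"
  shows "(y / x)^2 + 4 * (y / x) + 1 = 0"
proof -
  have "2 * y * (y^2 + 4 * x * y + x^2) = 0"
    using assms(1) by (simp add: cubic_poly_def algebra_simps power2_eq_square)
  then have "y^2 + 4 * x * y + x^2 = 0" using assms(3) by simp
  then have "(y^2 + 4 * x * y + x^2) / x^2 = 0" by simp
  then show ?thesis using assms(2) by (simp add: field_simps power2_eq_square)
qed

text \<open>
  On the line at infinity the cubic becomes \<open>x^3 + y^3 + z^3\<close>, which equals \<open>3 x y z\<close> there.
\<close>

lemma cubic_poly_infinite_point:
  assumes "cubic_poly x y z = 0" and "x + y + z = 0"
  shows "x * y * z = 0"
proof -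
  have opp: "y + z = - x" "x + z = - y" "x + y = - z" using assms(2) by auto
  have "cubic_poly x y z = x * (- x)^2 + y * (- y)^2 + z * (- z)^2"
    unfolding cubic_poly_def opp ..
  then have "x^3 + y^3 + z^3 = 0"
    using assms(1) by (simp add: power2_eq_square power3_eq_cube)
  moreover have "x^3 + y^3 + z^3 = 3 * (x * y * z)"
    using assms(2) by algebra
  ultimately show ?thesis by simp
qed

text \<open>
  A point of the cubic on a side is a vertex or the infinite point of that side, and all infinite
  points of the cubic are of this kind, so the remaining points can be normalized to
  \<open>x + y + z = 1\<close>.  On a median, outside the sides, the cubic reduces to \<open>t^2 + 4 t + 1 = 0\<close>.
\<close>

lemma cubic_ES_minus_T12:
  assumes tri: "is_triangle A B C"
  shows "cubic_ES A B C - T12 A B C =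
    {pt (x *\<^sub>R A + y *\<^sub>R B + z *\<^sub>R C) | x y z. x + y + z = 1 \<and> cubic_poly x y z = 0 \<and>
       x * y * z \<noteq> 0 \<and> (x - y) * (y - z) * (z - x) \<noteq> 0}" (is "?L = ?R")
proof (intro equalityI subsetI)
  fix P assume P: "P \<in> ?L"
  then obtain x y z where xyz: "P = bary A B C x y z" "(x, y, z) \<noteq> (0, 0, 0)" "cubic_poly x y z = 0"
    unfolding cubic_ES_def cubic_poly_def by blast
  have notin: "bary A B C x y z \<notin> T12 A B C" using P xyz(1) by blast
  have nz: "x \<noteq> 0" "y \<noteq> 0" "z \<noteq> 0"
  proof -
    show "x \<noteq> 0"
    proof
      assume "x = 0"
      then have "y = 0 \<or> z = 0 \<or> z = - y" using xyz cubic_poly_zero_weight by blast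
      then show False using T12_I(2,3,4)[of _ A B C] xyz(2) notin \<open>x = 0\<close> by auto
    qed
    show "y \<noteq> 0"
    proof
      assume "y = 0"
      then have "x = 0 \<or> z = 0 \<or> z = - x" using xyz cubic_poly_zero_weight cubic_poly_sym(1) by metis
      then show False using T12_I(1,3,5)[of _ A B C] xyz(2) notin \<open>y = 0\<close> by auto
    qed
    show "z \<noteq> 0"
    proof
      assume "z = 0"
      then have "x = 0 \<or> y = 0 \<or> y = - x" using xyz cubic_poly_zero_weight cubic_poly_sym by metis
      then show False using T12_I(1,2,6)[of _ A B C] xyz(2) notin \<open>z = 0\<close> by auto
    qed
  qed
  have ne: "x \<noteq> y" "y \<noteq> z" "z \<noteq> x"
  proof -
    show "y \<noteq> z"
    proof
      assume "y = z"
      then show False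
        using cubic_poly_equal_weights[of x y] T12_I(7)[OF nz(1), of "y / x" A B C] xyz(3) nz notin by simp
    qed
    show "z \<noteq> x"
    proof
      assume "z = x"
      then show False
        using cubic_poly_equal_weights[of y x] T12_I(8)[OF nz(2), of "x / y" A B C] xyz(3) nz notin
        by (simp add: cubic_poly_sym(1)[of x y])
    qed
    show "x \<noteq> y"
    proof
      assume "x = y"
      then show False
        using cubic_poly_equal_weights[of z x] T12_I(9)[OF nz(3), of "x / z" A B C] xyz(3) nz notin
          cubic_poly_sym(1)[of x z x] cubic_poly_sym(2)[of x z x] by simp
    qed
  qed
  define s where "s = x + y + z"
  have "s \<noteq> 0" using cubic_poly_infinite_point[OF xyz(3)] nz by (auto simp: s_def)
  define x' y' z' where "x' = x / s" and "y' = y / s" and "z' = z / s"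
  have sum: "x' + y' + z' = 1"
    using \<open>s \<noteq> 0\<close> by (simp add: x'_def y'_def z'_def s_def flip: add_divide_distrib)
  have "P = bary A B C x' y' z'"
    using bary_scale[OF \<open>s \<noteq> 0\<close>, of A B C x' y' z'] \<open>s \<noteq> 0\<close> xyz(1) by (simp add: x'_def y'_def z'_def)
  then have "P = pt (x' *\<^sub>R A + y' *\<^sub>R B + z' *\<^sub>R C)"
    by (simp add: bary_def pt_def sum)
  moreover have "cubic_poly x y z = s^3 * cubic_poly x' y' z'"
    using \<open>s \<noteq> 0\<close> by (simp add: x'_def y'_def z'_def cubic_poly_def power3_eq_cube power2_eq_square field_simps)
  then have "cubic_poly x' y' z' = 0" using xyz(3) \<open>s \<noteq> 0\<close> by simp
  moreover have "x' * y' * z' \<noteq> 0" "(x' - y') * (y' - z') * (z' - x') \<noteq> 0"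
    using nz ne \<open>s \<noteq> 0\<close> by (simp_all add: x'_def y'_def z'_def)
  ultimately show "P \<in> ?R" using sum by blast
next
  fix P assume "P \<in> ?R"
  then obtain x y z where xyz: "P = pt (x *\<^sub>R A + y *\<^sub>R B + z *\<^sub>R C)" "x + y + z = 1" "cubic_poly x y z = 0"
      "x * y * z \<noteq> 0" "(x - y) * (y - z) * (z - x) \<noteq> 0" by blast
  then have P: "P = bary A B C x y z" by (simp add: bary_def pt_def)
  then have "P \<in> cubic_ES A B C"
    unfolding cubic_ES_def using xyz by (auto simp: cubic_poly_def)
  moreover have "P \<notin> T12 A B C"
  proof
    assume "P \<in> T12 A B C"
    then obtain x' y' z' where eq: "bary A B C x y z = bary A B C x' y' z'"
      and prod: "x' * y' * z' * ((x' - y') * (y' - z') * (z' - x')) = 0"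
      unfolding P using T12_weights by metis
    then obtain c where c: "x = c * x'" "y = c * y'" "z = c * z'"
      using bary_eq_imp_proportional[OF tri eq] by blast
    show False using prod xyz(4,5) unfolding c by auto
  qed
  ultimately show "P \<in> ?L" by blast
qed
section \<open>The hyperbola in affine coordinates\<close>

locale plane_frame =
  fixes Z u w :: "real^2"
  assumes frame: "det2 u w \<noteq> 0"
begin

definition point :: "real \<Rightarrow> real \<Rightarrow> real^2" where
  "point h k = Z + h *\<^sub>R u + k *\<^sub>R w"

definition hc :: "real^2 \<Rightarrow> real" where
  "hc X = det2 (X - Z) w / det2 u w"

definition kc :: "real^2 \<Rightarrow> real" where
  "kc X = det2 u (X - Z) / det2 u w"

definition hyperbola :: "(real^2) set" where
  "hyperbola = {X. (kc X)^2 - 3 * (hc X)^2 = 1}"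

lemma coords_point [simp]: "hc (point h k) = h" "kc (point h k) = k"
  using frame by (simp_all add: hc_def kc_def point_def det2_simps)

lemma point_coords [simp]: "point (hc X) (kc X) = X"
  using det2_expand[OF frame, of "X - Z"] by (simp add: point_def hc_def kc_def algebra_simps)

lemma coords_eqI: "hc X = hc Y \<Longrightarrow> kc X = kc Y \<Longrightarrow> X = Y"
  by (metis point_coords)

lemma coords_combination:
  assumes "x + y + z = 1"
  shows "hc (x *\<^sub>R A + y *\<^sub>R B + z *\<^sub>R C) = x * hc A + y * hc B + z * hc C"
    and "kc (x *\<^sub>R A + y *\<^sub>R B + z *\<^sub>R C) = x * kc A + y * kc B + z * kc C"
proof -
  have "x *\<^sub>R Z + y *\<^sub>R Z + z *\<^sub>R Z = Z" using assms by (simp flip: scaleR_add_left)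
  then have "x *\<^sub>R A + y *\<^sub>R B + z *\<^sub>R C - Z = x *\<^sub>R (A - Z) + y *\<^sub>R (B - Z) + z *\<^sub>R (C - Z)"
    by (simp add: algebra_simps)
  then show "hc (x *\<^sub>R A + y *\<^sub>R B + z *\<^sub>R C) = x * hc A + y * hc B + z * hc C"
    and "kc (x *\<^sub>R A + y *\<^sub>R B + z *\<^sub>R C) = x * kc A + y * kc B + z * kc C"
    by (simp_all only: hc_def kc_def det2_simps(1,2,5,6) add_divide_distrib times_divide_eq_right)
qed

lemma coords_centroid:
  "hc (centroid A B C) = (hc A + hc B + hc C) / 3" "kc (centroid A B C) = (kc A + kc B + kc C) / 3"
  using coords_combination[of "1/3" "1/3" "1/3" A B C] by (simp_all add: centroid_def scaleR_add_right)

lemma coords_midpoint: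
  "hc (midpoint A B) = (hc A + hc B) / 2" "kc (midpoint A B) = (kc A + kc B) / 2"
  using coords_combination[of "1/2" "1/2" 0 A B A] by (simp_all add: midpoint_def scaleR_add_right)

lemma coords_line:
  "hc (A + t *\<^sub>R (C - B)) = hc A + t * (hc C - hc B)" "kc (A + t *\<^sub>R (C - B)) = kc A + t * (kc C - kc B)"
  using coords_combination[of 1 "-t" t A B C] by (simp_all add: algebra_simps)

lemma is_triangle_iff_area:
  "is_triangle A B C \<longleftrightarrow> area (hc A) (kc A) (hc B) (kc B) (hc C) (kc C) \<noteq> 0"
proof -
  have "X - Y = (hc X - hc Y) *\<^sub>R u + (kc X - kc Y) *\<^sub>R w" for X Y
    using arg_cong2[of _ _ _ _ "(-)", OF point_coords[of X] point_coords[of Y]]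
    by (simp add: point_def algebra_simps)
  then have "det2 (B - A) (C - A) = area (hc A) (kc A) (hc B) (kc B) (hc C) (kc C) * det2 u w"
    by (simp only: det2_simps(1,2,5,6,7) det2_swap[of w u]) (simp add: area_def algebra_simps)
  then show ?thesis using frame by (simp add: is_triangle_iff_det2)
qed

lemma continuous_on_coords:
  assumes "continuous_on T g"
  shows "continuous_on T (\<lambda>t. hc (g t))" "continuous_on T (\<lambda>t. kc (g t))"
  using frame unfolding hc_def kc_def det2_def by (auto intro!: continuous_intros assms)

text \<open>
  The \<open>k\<close>-coordinate has no zero on the hyperbola, so its sign is constant along the arc, and a point
  is determined by this sign together with its \<open>h\<close>-coordinate.  Hence \<open>h\<close> is injective along the arc,
  and by the intermediate value theorem it runs through the interval between its end values and does
  not leave it.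
\<close>

lemma closed_arc_hyperbola:
  assumes arc: "closed_arc hyperbola X Y K" and less: "hc X < hc Y"
  shows "K = {V \<in> hyperbola. hc X \<le> hc V \<and> hc V \<le> hc Y \<and> 0 < kc V * kc Y}"
proof -
  obtain g where g: "arc g" "pathstart g = X" "pathfinish g = Y" "path_image g = K" "K \<subseteq> hyperbola"
    using arc by (auto simp: closed_arc_def)
  define f where "f t = hc (g t)" for t
  define \<kappa> where "\<kappa> t = kc (g t)" for t
  have g01: "g 0 = X" "g 1 = Y" using g by (simp_all add: pathstart_def pathfinish_def)
  have K: "K = g ` {0..1}" using g by (simp add: path_image_def)
  have "continuous_on {0..1} g" "inj_on g {0..1}" using g(1) by (simp_all add: arc_def path_def)
  then have cont: "continuous_on {0..1} f" "continuous_on {0..1} \<kappa>"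
    unfolding f_def \<kappa>_def by (simp_all add: continuous_on_coords)
  have on: "(\<kappa> t)^2 - 3 * (f t)^2 = 1" if "t \<in> {0..1}" for t
    using that g(5) unfolding K hyperbola_def f_def \<kappa>_def by blast
  then have nz: "\<kappa> t \<noteq> 0" if "t \<in> {0..1}" for t using that pell_nonzero by blast
  have branch: "0 < \<kappa> t * \<kappa> 1" if t: "t \<in> {0..1}" for t
  proof (rule ccontr)
    assume "\<not> 0 < \<kappa> t * \<kappa> 1"
    then have "\<kappa> t * \<kappa> 1 \<le> 0" by simp
    moreover have "0 \<le> \<kappa> 1 * \<kappa> 1" by simp
    moreover have "continuous_on {t..1} (\<lambda>s. \<kappa> s * \<kappa> 1)"
      using t by (intro continuous_intros continuous_on_subset[OF cont(2)]) auto
    ultimately obtain s where "t \<le> s" "s \<le> 1" "\<kappa> s * \<kappa> 1 = 0"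
      using IVT'[of "\<lambda>s. \<kappa> s * \<kappa> 1" t 0 1] t by auto
    then show False using nz[of s] nz[of 1] t by auto
  qed
  have determined: "V = W"
    if "V \<in> hyperbola" "W \<in> hyperbola" "hc V = hc W" "0 < kc V * kc Y" "0 < kc W * kc Y" for V W
  proof (rule coords_eqI)
    have "(kc V)^2 = (kc W)^2" using that by (simp add: hyperbola_def)
    then show "kc V = kc W" using that by (auto simp: power2_eq_iff zero_less_mult_iff)
  qed fact
  have inj: "s = t" if "s \<in> {0..1}" "t \<in> {0..1}" "f s = f t" for s t
  proof -
    have "g s \<in> hyperbola" "g t \<in> hyperbola" using that g(5) K by auto
    then have "g s = g t"
      using determined branch that g01 by (simp add: f_def \<kappa>_def)
    then show ?thesis using \<open>inj_on g {0..1}\<close> that by (simp add: inj_on_def)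
  qed
  have f01: "f 0 < f 1" using less g01 by (simp add: f_def)
  have bounds: "f 0 \<le> f t \<and> f t \<le> f 1" if t: "t \<in> {0..1}" for t
  proof (rule ccontr)
    assume "\<not> ?thesis"
    then consider "f t < f 0" | "f 1 < f t" by linarith
    then show False
    proof cases
      case 1
      have "continuous_on {t..1} f" using t by (intro continuous_on_subset[OF cont(1)]) auto
      then obtain s where "t \<le> s" "s \<le> 1" "f s = f 0"
        using IVT'[of f t "f 0" 1] 1 f01 t by auto
      then show False using inj[of s 0] t 1 by auto
    next
      case 2
      have "continuous_on {0..t} f" using t by (intro continuous_on_subset[OF cont(1)]) auto
      then obtain s where "0 \<le> s" "s \<le> t" "f s = f 1"
        using IVT'[of f 0 "f 1" t] 2 f01 t by auto
      then show False using inj[of s 1] t 2 by auto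
    qed
  qed
  show ?thesis
  proof (intro equalityI subsetI)
    fix V assume "V \<in> K"
    then obtain t where "t \<in> {0..1}" "V = g t" using K by blast
    then show "V \<in> {V \<in> hyperbola. hc X \<le> hc V \<and> hc V \<le> hc Y \<and> 0 < kc V * kc Y}"
      using bounds[of t] branch[of t] g(5) \<open>V \<in> K\<close> g01 by (auto simp: f_def \<kappa>_def)
  next
    fix V assume V: "V \<in> {V \<in> hyperbola. hc X \<le> hc V \<and> hc V \<le> hc Y \<and> 0 < kc V * kc Y}"
    then obtain t where t: "0 \<le> t" "t \<le> 1" "f t = hc V"
      using IVT'[of f 0 "hc V" 1] cont(1) g01 by (auto simp: f_def)
    then have "g t \<in> K" using K by auto
    moreover have "V = g t"
      using V t branch[of t] \<open>g t \<in> K\<close> g(5) g01 by (intro determined) (auto simp: f_def \<kappa>_def)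
    ultimately show "V \<in> K" by simp
  qed
qed

text \<open>
  The five points impose five independent linear conditions on the six coefficients of the quadratic
  form, so the form is a multiple of that of the hyperbola; the multiple is nonzero because the form
  is.
\<close>

lemma conic_affine_part:
  assumes "is_conic S"
    and "pt ` {point 1 2, point 1 (-2), point (-1) (-2), point 0 1, point 0 (-1)} \<subseteq> S"
  shows "affine_part S = hyperbola"
proof -
  obtain \<beta> :: "(real^2) \<times> real \<Rightarrow> (real^2) \<times> real \<Rightarrow> real"
    where bil: "bilinear \<beta>" and nz: "\<exists>v. \<beta> v v \<noteq> 0"
      and S: "S = {span {v} | v. v \<noteq> 0 \<and> \<beta> v v = 0}"
    using assms(1) by (auto simp: is_conic_def)
  define e0 :: "(real^2) \<times> real" where "e0 = (Z, 1)"
  define e1 :: "(real^2) \<times> real" where "e1 = (u, 0)"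
  define e2 :: "(real^2) \<times> real" where "e2 = (w, 0)"
  define vec where "vec a b c = a *\<^sub>R e1 + b *\<^sub>R e2 + c *\<^sub>R e0" for a b c
  have form: "\<beta> (vec a b c) (vec a b c) = a^2 * \<beta> e1 e1 + a * b * (\<beta> e1 e2 + \<beta> e2 e1) + b^2 * \<beta> e2 e2
      + a * c * (\<beta> e1 e0 + \<beta> e0 e1) + b * c * (\<beta> e2 e0 + \<beta> e0 e2) + c^2 * \<beta> e0 e0" for a b c
    unfolding vec_def
    by (simp add: bilinear_ladd[OF bil] bilinear_radd[OF bil] bilinear_lmul[OF bil] bilinear_rmul[OF bil]
        algebra_simps power2_eq_square)
  have pt_vec: "(point h k, 1) = vec h k 1" for h k
    by (simp add: vec_def e0_def e1_def e2_def point_def)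
  have pt_in: "pt X \<in> S \<longleftrightarrow> \<beta> (X, 1) (X, 1) = 0" for X
  proof
    assume "pt X \<in> S"
    then obtain v where v: "span {v} = span {(X, 1)}" "\<beta> v v = 0"
      unfolding S pt_def by auto
    then have "(X, 1) \<in> span {v}" by (metis insertI1 span_base)
    then obtain c where "(X, 1) = c *\<^sub>R v" by (auto simp: span_singleton)
    then show "\<beta> (X, 1) (X, 1) = 0"
      using v(2) by (simp add: bilinear_lmul[OF bil] bilinear_rmul[OF bil])
  next
    assume "\<beta> (X, 1) (X, 1) = 0"
    moreover have "(X, 1::real) \<noteq> 0" by (simp add: zero_prod_def)
    ultimately show "pt X \<in> S" unfolding S pt_def by blast
  qed
  have zero: "\<beta> (vec h k 1) (vec h k 1) = 0" if "pt (point h k) \<in> S" for h k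
    using that unfolding pt_in pt_vec .
  have five: "\<beta> (vec 1 2 1) (vec 1 2 1) = 0" "\<beta> (vec 1 (-2) 1) (vec 1 (-2) 1) = 0"
    "\<beta> (vec (-1) (-2) 1) (vec (-1) (-2) 1) = 0" "\<beta> (vec 0 1 1) (vec 0 1 1) = 0"
    "\<beta> (vec 0 (-1) 1) (vec 0 (-1) 1) = 0"
    using assms(2) by (auto intro: zero)
  define m where "m = \<beta> e2 e2"
  have coeffs: "\<beta> e1 e1 = - 3 * m" "\<beta> e1 e2 + \<beta> e2 e1 = 0" "\<beta> e0 e0 = - m"
    "\<beta> e1 e0 + \<beta> e0 e1 = 0" "\<beta> e2 e0 + \<beta> e0 e2 = 0"
    using five unfolding form by (simp_all add: m_def)
  have form': "\<beta> (vec a b c) (vec a b c) = m * (b^2 - 3 * a^2 - c^2)" for a b c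
    unfolding form coeffs by (simp add: m_def[symmetric] algebra_simps)
  have "m \<noteq> 0"
  proof
    assume "m = 0"
    obtain d c where v: "\<beta> (d, c) (d, c) \<noteq> 0" using nz by (metis surj_pair)
    define a where "a = det2 (d - c *\<^sub>R Z) w / det2 u w"
    define b where "b = det2 u (d - c *\<^sub>R Z) / det2 u w"
    have "d - c *\<^sub>R Z = a *\<^sub>R u + b *\<^sub>R w"
      unfolding a_def b_def by (rule det2_expand[OF frame])
    then have "(d, c) = vec a b c"
      by (simp add: vec_def e0_def e1_def e2_def algebra_simps)
    then show False using v form' \<open>m = 0\<close> by simp
  qed
  have "pt X \<in> S \<longleftrightarrow> X \<in> hyperbola" for X
  proof -
    have "pt X \<in> S \<longleftrightarrow> m * ((kc X)^2 - 3 * (hc X)^2 - 1^2) = 0"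
      unfolding pt_in using pt_vec[of "hc X" "kc X"] form' by simp
    then show ?thesis using \<open>m \<noteq> 0\<close> by (simp add: hyperbola_def)
  qed
  then show ?thesis by (auto simp: affine_part_def)
qed

end
section \<open>The locus of images of the point P1\<close>

theorem theorem4p5:
  fixes A B C :: "real^2"
    and H1 U1 P1 V1 Z1 O1 G1 Q1 Q1' P1' E F :: "real^2"
    and \<rho> :: "real^2 \<Rightarrow> real^2"
    and \<C> \<A> :: "ext_point set"
    and \<E> \<F> :: "(real^2) set"
    and Ainf Binf :: ext_point
  assumes ABC: "is_triangle A B C"
    and par: "parallelogram H1 U1 P1 V1"
    and Z1: "Z1 = midpoint U1 V1" "Z1 = midpoint H1 P1"
    and O1: "O1 = midpoint U1 P1"
    and G1: "affine hull {U1, V1} \<inter> affine hull {H1, O1} = {G1}"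
    and Q1: "Q1 = midpoint P1 V1"
    and Q1': "Q1' = midpoint H1 U1"
    and P1': "affine_reflection (affine hull {U1, V1}) (P1 - U1) \<rho>" "P1' = \<rho> P1"
    and conic: "is_conic \<C>" "pt ` {P1, Q1, H1, Q1', P1'} \<subseteq> \<C>"
    and EF: "{G1 + t *\<^sub>R (P1' - P1) | t. True} \<inter> affine_part \<C> = {E, F}"
    and E_branch: "connected_component (affine_part \<C>) P1' E"
                  "connected_component (affine_part \<C>) Q1' E"
    and F_branch: "connected_component (affine_part \<C>) P1 F"
                  "connected_component (affine_part \<C>) Q1 F"
    and arc_E: "closed_arc (affine_part \<C>) E P1' \<E>"
    and arc_F: "closed_arc (affine_part \<C>) F P1 \<F>"
    and inf: "\<C> \<inter> line_at_infinity = {Ainf, Binf}" "Ainf \<noteq> Binf"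
    and \<A>: "\<A> = \<C> - (pt ` (\<E> \<union> \<F>) \<union> {pt Q1, pt Q1', Ainf, Binf})"
  shows "(\<forall>A1. pt A1 \<in> \<A> \<longrightarrow>
            (\<exists>!S. \<exists>B1 C1. S = {B1, C1} \<and> pt B1 \<in> \<C> \<and> pt C1 \<in> \<C> \<and>
               is_triangle A1 B1 C1 \<and> centroid A1 B1 C1 = G1)) \<and>
         cubic_ES A B C - T12 A B C =
           {pt (f P1) | f A1 B1 C1.
              pt A1 \<in> \<A> \<and> pt B1 \<in> \<C> \<and> pt C1 \<in> \<C> \<and>
              is_triangle A1 B1 C1 \<and> centroid A1 B1 C1 = G1 \<and>
              affine_map f \<and>
              ((f A1 = A \<and> f B1 = B \<and> f C1 = C) \<or> (f A1 = A \<and> f C1 = B \<and> f B1 = C))}"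
proof -
  define u where "u = U1 - Z1"
  \<comment> \<open>The factor \<open>1/2\<close> puts \<open>P1\<close> at \<open>(1, 2)\<close>, which makes the equation of the conic \<open>k^2 - 3 h^2 = 1\<close>.\<close>
  define w where "w = (1/2) *\<^sub>R (P1 - U1)"
  have U1_uw: "U1 = Z1 + u"
    by (simp add: u_def)
  have P1_uw: "P1 = Z1 + u + 2 *\<^sub>R w"
    by (simp add: u_def w_def)
  have "2 *\<^sub>R Z1 = U1 + V1" "2 *\<^sub>R Z1 = H1 + P1"
    using Z1 midpoint_eq_iff scaleR_2 by metis+
  then have V1_uw: "V1 = Z1 - u" and H1_uw: "H1 = Z1 - u - 2 *\<^sub>R w"
    unfolding P1_uw by (simp_all add: u_def scaleR_2 algebra_simps)
  interpret plane_frame Z1 u w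
  proof
    have "U1 - H1 = 2 *\<^sub>R u + 2 *\<^sub>R w" "P1 - H1 = 2 *\<^sub>R u + 4 *\<^sub>R w"
      unfolding H1_uw P1_uw by (simp_all add: u_def vec_eq_iff)
    then have "det2 (U1 - H1) (P1 - H1) = 4 * det2 u w"
      by (simp add: det2_simps det2_swap[of w u])
    moreover have "det2 (U1 - H1) (P1 - H1) \<noteq> 0"
      using par unfolding parallelogram_def is_triangle_iff_det2 by blast
    ultimately show "det2 u w \<noteq> 0" by simp
  qed
  have pts: "U1 = point 1 0" "V1 = point (-1) 0" "P1 = point 1 2" "H1 = point (-1) (-2)"
    by (simp_all add: point_def U1_uw V1_uw P1_uw H1_uw)
  have Q1_pt: "Q1 = point 0 1" and Q1'_pt: "Q1' = point 0 (-1)"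
    by (rule coords_eqI; simp add: Q1 Q1' coords_midpoint pts)+
  have G1_coords: "hc G1 = 1/3" "kc G1 = 0"
  proof -
    have G: "G1 \<in> affine hull {U1, V1}" "G1 \<in> affine hull {H1, O1}" using G1 by auto
    obtain a b where ab: "G1 = a *\<^sub>R U1 + b *\<^sub>R V1" "a + b = 1"
      using G(1) unfolding affine_hull_2 by blast
    obtain c d where cd: "G1 = c *\<^sub>R H1 + d *\<^sub>R O1" "c + d = 1"
      using G(2) unfolding affine_hull_2 by blast
    show k: "kc G1 = 0"
      using ab coords_combination(2)[of a b 0 U1 V1 U1] by (simp add: pts)
    have O: "hc O1 = 1" "kc O1 = 1" by (simp_all add: O1 coords_midpoint pts)
    have "hc G1 = d - c" "kc G1 = d - 2 * c"
      using cd coords_combination[of c d 0 H1 O1 H1] O by (simp_all add: pts)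
    then show "hc G1 = 1/3" using k cd(2) by linarith
  qed
  have P1'_pt: "P1' = point 1 (-2)"
  proof -
    have "P1' - P1 \<in> span {P1 - U1}" and mid: "midpoint P1 P1' \<in> affine hull {U1, V1}"
      using P1' by (auto simp: affine_reflection_def)
    then obtain c where "P1' - P1 = c *\<^sub>R (P1 - U1)" by (auto simp: span_singleton)
    then have c: "P1' = P1 + c *\<^sub>R (P1 - U1)" by (simp add: algebra_simps)
    have h: "hc P1' = 1" "kc P1' = 2 + 2 * c" unfolding c coords_line by (simp_all add: pts)
    obtain a b where ab: "midpoint P1 P1' = a *\<^sub>R U1 + b *\<^sub>R V1" "a + b = 1"
      using mid unfolding affine_hull_2 by blast
    have "kc (midpoint P1 P1') = 0"
      using ab coords_combination(2)[of a b 0 U1 V1 U1] by (simp add: pts)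
    then have "kc P1' = -2" by (simp add: coords_midpoint pts)
    then show ?thesis using h by (intro coords_eqI) auto
  qed
  have "pt ` {point 1 2, point 1 (-2), point (-1) (-2), point 0 1, point 0 (-1)} \<subseteq> \<C>"
    using conic(2) unfolding P1'_pt Q1_pt Q1'_pt pts by auto
  then have aff: "affine_part \<C> = hyperbola"
    by (rule conic_affine_part[OF conic(1)])
  then have in_C: "pt X \<in> \<C> \<longleftrightarrow> X \<in> hyperbola" for X
    by (auto simp: affine_part_def)
  have third: "hc X = 1/3" if X: "X \<in> {E, F}" for X
  proof -
    obtain t where "X = G1 + t *\<^sub>R (P1' - P1)"
      using X unfolding EF[symmetric] by blast
    then show ?thesis
      using coords_line(1)[of G1 t P1' P1] by (simp add: G1_coords P1'_pt pts)
  qed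
  have arcs: "\<E> = {V \<in> hyperbola. 1/3 \<le> hc V \<and> hc V \<le> 1 \<and> kc V < 0}"
    "\<F> = {V \<in> hyperbola. 1/3 \<le> hc V \<and> hc V \<le> 1 \<and> 0 < kc V}"
    using closed_arc_hyperbola[OF arc_E[unfolded aff]] closed_arc_hyperbola[OF arc_F[unfolded aff]]
      third[of E] third[of F] by (simp_all add: P1'_pt pts zero_less_mult_iff)
  have "Ainf \<in> line_at_infinity" "Binf \<in> line_at_infinity" using inf by auto
  then have not_inf: "pt X \<noteq> Ainf" "pt X \<noteq> Binf" for X using pt_not_at_infinity by metis+
  have Q_iff: "X \<in> {Q1, Q1'} \<longleftrightarrow> hc X = 0" if "X \<in> hyperbola" for X
  proof
    assume "hc X = 0"
    then have "kc X = 1 \<or> kc X = - 1" using that by (simp add: hyperbola_def power2_eq_1_iff)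
    then show "X \<in> {Q1, Q1'}"
      using \<open>hc X = 0\<close> by (auto simp: Q1_pt Q1'_pt intro: coords_eqI)
  qed (auto simp: Q1_pt Q1'_pt)
  have in_A: "pt X \<in> \<A> \<longleftrightarrow> X \<in> hyperbola \<and> hc X \<noteq> 0 \<and> (hc X < 1/3 \<or> 1 < hc X)" for X
  proof -
    have "pt X \<in> pt ` S \<longleftrightarrow> X \<in> S" for S by (auto simp: pt_eq_iff)
    then have "pt X \<in> \<A> \<longleftrightarrow> X \<in> hyperbola \<and> X \<notin> \<E> \<union> \<F> \<and> X \<notin> {Q1, Q1'}"
      by (simp add: \<A> in_C not_inf pt_eq_iff conj_ac)
    moreover have "X \<in> \<E> \<union> \<F> \<longleftrightarrow> 1/3 \<le> hc X \<and> hc X \<le> 1" if "X \<in> hyperbola"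
      using that pell_nonzero[of "kc X" "hc X"] by (auto simp: arcs hyperbola_def)
    ultimately show ?thesis using Q_iff[of X] by (meson not_le)
  qed
  have triple_iff: "pt A1 \<in> \<C> \<and> pt B1 \<in> \<C> \<and> pt C1 \<in> \<C> \<and> centroid A1 B1 C1 = G1 \<longleftrightarrow>
      pell_triple (hc A1) (kc A1) (hc B1) (kc B1) (hc C1) (kc C1)" for A1 B1 C1
  proof -
    have "centroid A1 B1 C1 = G1 \<longleftrightarrow>
        hc (centroid A1 B1 C1) = hc G1 \<and> kc (centroid A1 B1 C1) = kc G1"
      using coords_eqI by auto
    then show ?thesis
      by (auto simp: in_C hyperbola_def pell_triple_def coords_centroid G1_coords)
  qed
  show ?thesis
  proof (intro conjI allI impI)
    fix A1 assume "pt A1 \<in> \<A>"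
    then have A1: "A1 \<in> hyperbola" "hc A1 \<noteq> 0" "hc A1 < 1/3 \<or> 1 < hc A1" by (simp_all add: in_A)
    then obtain h1 k1 h2 k2 where t: "pell_triple (hc A1) (kc A1) h1 k1 h2 k2"
      "area (hc A1) (kc A1) h1 k1 h2 k2 \<noteq> 0"
      using pell_triple_exists[of "kc A1" "hc A1"] by (auto simp: hyperbola_def)
    show "\<exists>!S. \<exists>B1 C1. S = {B1, C1} \<and> pt B1 \<in> \<C> \<and> pt C1 \<in> \<C> \<and>
        is_triangle A1 B1 C1 \<and> centroid A1 B1 C1 = G1"
    proof (rule ex1I)
      show "\<exists>B1 C1. {point h1 k1, point h2 k2} = {B1, C1} \<and> pt B1 \<in> \<C> \<and> pt C1 \<in> \<C> \<and>
          is_triangle A1 B1 C1 \<and> centroid A1 B1 C1 = G1"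
        using triple_iff[of A1 "point h1 k1" "point h2 k2"] t
        by (intro exI[of _ "point h1 k1"] exI[of _ "point h2 k2"]) (simp add: is_triangle_iff_area)
      fix S assume "\<exists>B1 C1. S = {B1, C1} \<and> pt B1 \<in> \<C> \<and> pt C1 \<in> \<C> \<and>
          is_triangle A1 B1 C1 \<and> centroid A1 B1 C1 = G1"
      then obtain B1 C1 where S: "S = {B1, C1}"
        and t': "pell_triple (hc A1) (kc A1) (hc B1) (kc B1) (hc C1) (kc C1)"
        using triple_iff A1(1) in_C by metis
      have "hc A1 \<noteq> 1/3" using A1(3) by auto
      have "B1 = point h1 k1 \<and> C1 = point h2 k2 \<or> B1 = point h2 k2 \<and> C1 = point h1 k1"
        using pell_triple_unique[OF t(1) t'] \<open>hc A1 \<noteq> 1/3\<close> by (metis point_coords)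
      then show "S = {point h1 k1, point h2 k2}" using S by auto
    qed
  next
    \<comment> \<open>Both orders of the vertices reduce to this one, since exchanging \<open>B1\<close> and \<open>C1\<close> preserves all
      conditions on the triangle.\<close>
    have image: "pt (f P1) \<in> cubic_ES A B C - T12 A B C"
      if t: "pell_triple (hc A1) (kc A1) (hc B1) (kc B1) (hc C1) (kc C1)"
        and tri: "is_triangle A1 B1 C1" and f: "affine_map f" "f A1 = A" "f B1 = B" "f C1 = C"
      for f A1 B1 C1
    proof -
      obtain x y z where xyz: "x + y + z = 1" "P1 = x *\<^sub>R A1 + y *\<^sub>R B1 + z *\<^sub>R C1"
        using barycentric_weights_exist[OF tri] .
      have P: "x * hc A1 + y * hc B1 + z * hc C1 = 1" "x * kc A1 + y * kc B1 + z * kc C1 = 2"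
        unfolding coords_combination[OF xyz(1), symmetric] xyz(2)[symmetric] by (simp_all add: pts)
      have area: "area (hc A1) (kc A1) (hc B1) (kc B1) (hc C1) (kc C1) \<noteq> 0"
        using tri by (simp add: is_triangle_iff_area)
      note t2 = pell_triple_rotate[OF t] and t3 = pell_triple_rotate[OF pell_triple_rotate[OF t]]
      have "hc A1 \<noteq> 1" "hc B1 \<noteq> 1" "hc C1 \<noteq> 1"
        using pell_triple_range(2)[OF t] pell_triple_range(2)[OF t2] pell_triple_range(2)[OF t3] area
        by (auto simp: area_rotate)
      then have "cubic_poly x y z = 0" "x * y * z \<noteq> 0" "(x - y) * (y - z) * (z - x) \<noteq> 0"
        using weight_system_cubic[OF pell_triple_weight_system[OF t xyz(1) P]] by simp_all
      moreover have "pt (f P1) = pt (x *\<^sub>R A + y *\<^sub>R B + z *\<^sub>R C)"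
        using affine_map_combination[OF f(1) xyz(1), of A1 B1 C1] f xyz(2) by metis
      ultimately show ?thesis
        unfolding cubic_ES_minus_T12[OF ABC] using xyz(1) by blast
    qed
    show "cubic_ES A B C - T12 A B C =
           {pt (f P1) | f A1 B1 C1.
              pt A1 \<in> \<A> \<and> pt B1 \<in> \<C> \<and> pt C1 \<in> \<C> \<and>
              is_triangle A1 B1 C1 \<and> centroid A1 B1 C1 = G1 \<and>
              affine_map f \<and>
              ((f A1 = A \<and> f B1 = B \<and> f C1 = C) \<or> (f A1 = A \<and> f C1 = B \<and> f B1 = C))}"
      (is "?L = ?R")
    proof (intro equalityI subsetI)
      fix X assume "X \<in> ?R"
      then obtain f A1 B1 C1 where X: "X = pt (f P1)" "pt A1 \<in> \<A>" "pt B1 \<in> \<C>" "pt C1 \<in> \<C>"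
        "is_triangle A1 B1 C1" "centroid A1 B1 C1 = G1" "affine_map f"
        "(f A1 = A \<and> f B1 = B \<and> f C1 = C) \<or> (f A1 = A \<and> f C1 = B \<and> f B1 = C)" by blast
      have t: "pell_triple (hc A1) (kc A1) (hc B1) (kc B1) (hc C1) (kc C1)"
        using triple_iff[of A1 B1 C1] X in_A[of A1] in_C by simp
      then have t': "pell_triple (hc A1) (kc A1) (hc C1) (kc C1) (hc B1) (kc B1)"
        by (auto simp: pell_triple_def)
      have tri': "is_triangle A1 C1 B1"
        using X(5) by (simp add: is_triangle_def insert_commute)
      from X(8) show "X \<in> ?L"
        unfolding X(1) using image[OF t X(5,7)] image[OF t' tri' X(7)] by blast
    next
      fix X assume "X \<in> ?L"
      then obtain x y z where X: "X = pt (x *\<^sub>R A + y *\<^sub>R B + z *\<^sub>R C)" and sum: "x + y + z = 1"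
        and K: "cubic_poly x y z = 0" "x * y * z \<noteq> 0" "(x - y) * (y - z) * (z - x) \<noteq> 0"
        unfolding cubic_ES_minus_T12[OF ABC] by blast
      obtain h k h1 k1 h2 k2 where t: "pell_triple h k h1 k1 h2 k2" "area h k h1 k1 h2 k2 \<noteq> 0"
        and P: "x * h + y * h1 + z * h2 = 1" "x * k + y * k1 + z * k2 = 2"
        using cubic_imp_weight_system[OF sum K] weight_system_pell_triple by metis
      define A1 B1 C1 where "A1 = point h k" and "B1 = point h1 k1" and "C1 = point h2 k2"
      have conf: "pt A1 \<in> \<C>" "pt B1 \<in> \<C>" "pt C1 \<in> \<C>" "centroid A1 B1 C1 = G1"
        using triple_iff[of A1 B1 C1] t(1) by (simp_all add: A1_def B1_def C1_def)
      have tri: "is_triangle A1 B1 C1"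
        using t(2) by (simp add: is_triangle_iff_area A1_def B1_def C1_def)
      have "pt A1 \<in> \<A>"
        using pell_triple_range[OF t] conf(1) in_C by (simp add: in_A A1_def)
      have "P1 = x *\<^sub>R A1 + y *\<^sub>R B1 + z *\<^sub>R C1"
        by (rule coords_eqI)
          (simp_all add: coords_combination[OF sum] P A1_def B1_def C1_def pts)
      moreover obtain f where f: "affine_map f" "f A1 = A" "f B1 = B" "f C1 = C"
        using affine_map_between_triangles[OF tri ABC] .
      ultimately have "X = pt (f P1)"
        using affine_map_combination[OF f(1) sum, of A1 B1 C1] X by simp
      then show "X \<in> ?R"
        using \<open>pt A1 \<in> \<A>\<close> conf tri f by blast
    qed
  qed
qed

end
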